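(* If $G$ is a bi-orderable hyperbolic group, then $\mathrm{Aut}(G)$ acts faithfully on $\partial G$.
   Context: A group $G$ is bi-orderable if it admits a strict total ordering $<$ such that $g<h$ implies $fg<fh$ and $gf<hf$ for all $f,g,h\in G$. Hyperbolic means (finitely generated and) word-hyperbolic in the sense of Gromov, $\partial G$ denotes the Gromov boundary of $G$, and $\mathrm{Aut}(G)$ acts on $\partial G$ in the natural way (every automorphism is a quasi-isometry of $G$ and so induces a homeomorphism of $\partial G$). *)

theory Defs
  imports Complex_Main "HOL-Algebra.Algebra"
begin

definition bi_orderable :: "('a, 'b) monoid_scheme \<Rightarrow> bool"
  where "bi_orderable G \<longleftrightarrow>
    (\<exists>r. r \<subseteq> carrier G \<times> carrier G \<and> strict_linear_order_on (carrier G) r \<and>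
      (\<forall>f\<in>carrier G. \<forall>g\<in>carrier G. \<forall>h\<in>carrier G. (g, h) \<in> r \<longrightarrow>
         (f \<otimes>\<^bsub>G\<^esub> g, f \<otimes>\<^bsub>G\<^esub> h) \<in> r \<and> (g \<otimes>\<^bsub>G\<^esub> f, h \<otimes>\<^bsub>G\<^esub> f) \<in> r))"

definition finite_generating_set :: "('a, 'b) monoid_scheme \<Rightarrow> 'a set \<Rightarrow> bool"
  where "finite_generating_set G S \<longleftrightarrow>
    finite S \<and> S \<subseteq> carrier G \<and> generate G S = carrier G"

text \<open>Only meaningful for elements of \<^term>\<open>generate G S\<close>; elsewhere the
  minimum is taken over the empty set.\<close>

definition word_length :: "('a, 'b) monoid_scheme \<Rightarrow> 'a set \<Rightarrow> 'a \<Rightarrow> nat"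
  where "word_length G S g =
    (LEAST n. \<exists>ws. set ws \<subseteq> S \<union> m_inv G ` S \<and> length ws = n \<and>
                   foldr (\<otimes>\<^bsub>G\<^esub>) ws \<one>\<^bsub>G\<^esub> = g)"

definition word_dist :: "('a, 'b) monoid_scheme \<Rightarrow> 'a set \<Rightarrow> 'a \<Rightarrow> 'a \<Rightarrow> real"
  where "word_dist G S g h = real (word_length G S (inv\<^bsub>G\<^esub> g \<otimes>\<^bsub>G\<^esub> h))"

text \<open>The Gromov product of \<open>x\<close> and \<open>y\<close> at the base point \<open>w\<close>.\<close>

definition gromov_product :: "('a \<Rightarrow> 'a \<Rightarrow> real) \<Rightarrow> 'a \<Rightarrow> 'a \<Rightarrow> 'a \<Rightarrow> real"
  where "gromov_product d w x y = (d x w + d y w - d x y) / 2"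

definition gromov_hyperbolic :: "'a set \<Rightarrow> ('a \<Rightarrow> 'a \<Rightarrow> real) \<Rightarrow> bool"
  where "gromov_hyperbolic M d \<longleftrightarrow>
    (\<exists>\<delta>. \<forall>w\<in>M. \<forall>x\<in>M. \<forall>y\<in>M. \<forall>z\<in>M.
       gromov_product d w x z \<ge> min (gromov_product d w x y) (gromov_product d w y z) - \<delta>)"

text \<open>Gromov's inequality is imposed on the group with its word metric, i.e. on the
  vertices of the Cayley graph; every point of the Cayley graph is within \<open>1/2\<close> of a
  vertex, so passing to the whole graph only changes \<open>\<delta>\<close>.\<close>

definition hyperbolic_group :: "('a, 'b) monoid_scheme \<Rightarrow> bool"
  where "hyperbolic_group G \<longleftrightarrow> group G \<and>
    (\<exists>S. finite_generating_set G S \<and> gromov_hyperbolic (carrier G) (word_dist G S))"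

text \<open>Sequential model of the Gromov boundary: sequences with
  \<open>(x\<^sub>i | x\<^sub>j) \<rightarrow> \<infinity>\<close> as \<open>i, j \<rightarrow> \<infinity>\<close>, where \<open>x\<close> and \<open>y\<close> are identified
  if \<open>(x\<^sub>i | y\<^sub>j) \<rightarrow> \<infinity>\<close> as \<open>i, j \<rightarrow> \<infinity>\<close>. The base point is the identity.\<close>

definition gromov_seqs :: "('a, 'b) monoid_scheme \<Rightarrow> 'a set \<Rightarrow> (nat \<Rightarrow> 'a) set"
  where "gromov_seqs G S = {x. range x \<subseteq> carrier G \<and>
    filterlim (\<lambda>(i, j). gromov_product (word_dist G S) \<one>\<^bsub>G\<^esub> (x i) (x j))
      at_top (sequentially \<times>\<^sub>F sequentially)}"

definition boundary_rel :: "('a, 'b) monoid_scheme \<Rightarrow> 'a set \<Rightarrow> ((nat \<Rightarrow> 'a) \<times> (nat \<Rightarrow> 'a)) set"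
  where "boundary_rel G S = {(x, y). x \<in> gromov_seqs G S \<and> y \<in> gromov_seqs G S \<and>
    filterlim (\<lambda>(i, j). gromov_product (word_dist G S) \<one>\<^bsub>G\<^esub> (x i) (y j))
      at_top (sequentially \<times>\<^sub>F sequentially)}"

definition gromov_boundary :: "('a, 'b) monoid_scheme \<Rightarrow> 'a set \<Rightarrow> (nat \<Rightarrow> 'a) set set"
  where "gromov_boundary G S = gromov_seqs G S // boundary_rel G S"

text \<open>The map \<open>[x] \<mapsto> [f \<circ> x]\<close>. It is cut down to the boundary because
  \<^const>\<open>BijGroup\<close>, and hence \<^locale>\<open>group_action\<close>, uses extensional functions.\<close>

definition boundary_map ::
    "('a, 'b) monoid_scheme \<Rightarrow> 'a set \<Rightarrow> ('a \<Rightarrow> 'a) \<Rightarrow> (nat \<Rightarrow> 'a) set \<Rightarrow> (nat \<Rightarrow> 'a) set"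
  where "boundary_map G S f =
    (\<lambda>\<xi>\<in>gromov_boundary G S. \<Union>x\<in>\<xi>. boundary_rel G S `` {f \<circ> x})"

end

theory Submission
  imports Defs "HOL-Library.Diagonal_Subsequence"
begin

text \<open>
  Let \<open>f\<close> be an automorphism of \<open>G\<close> that fixes every boundary point, and let \<open>g\<close> be an element of
  \<open>G\<close>. Since \<open>f (g \<xi>) = f g (f \<xi>)\<close> for every boundary point \<open>\<xi>\<close>, the element \<open>k = g\<inverse> f g\<close> acts
  trivially on the boundary by left translation; the claim is that \<open>k = \<one>\<close>. Assume otherwise. A
  bi-orderable group has unique roots, so it is torsion-free, and \<open>G\<close> is infinite.

  The first step is that \<open>k\<close> is central. Compactness gives a bi-infinite geodesic through \<open>\<one>\<close>. Its
  translate by any \<open>h\<close> passes through \<open>h\<close> and has both ends fixed by \<open>k\<close>, so \<open>k\<close> shifts \<open>h\<close> along it,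
  by an amount that the Busemann functions of the ends bound by the length of \<open>k\<close> plus a constant
  (\<open>fixes_boundary_conjugates_bounded\<close>). Hence \<open>k\<close> has only finitely many conjugates, it commutes with a
  positive power of every element, and by uniqueness of roots with every element
  (\<open>fixes_boundary_central\<close>).

  The second step is that \<open>G\<close> is infinite cyclic. A central element \<open>u\<close> moves all points equally far, which
  in a hyperbolic space forces \<open>\<bar>u\<^sup>2\<bar> \<ge> 2 \<bar>u\<bar> - const\<close> (\<open>central_square_length\<close>). Two applications of the
  four-point inequality then bound the shortest element of each coset of the powers of \<open>k\<close>
  (\<open>central_cosets_bounded\<close>), so these powers have finite index. Unique roots make \<open>G\<close> abelian and
  cyclic.

  The only automorphisms of an infinite cyclic group are the identity and inversion, and \<open>f\<close> is not the
  identity. Inversion, however, moves every boundary point: all elements being central, \<open>(u | u\<inverse>)\<close> stays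
  bounded by the estimate for \<open>\<bar>u\<^sup>2\<bar>\<close>.

  That automorphisms act on the boundary at all, and that the boundary can be computed with a generating set
  for which the word metric is known to be hyperbolic, rests on one comparison: Gromov products of two
  bilipschitz path metrics tend to infinity together when one of the metrics is hyperbolic
  (\<open>gromov_products_comparable\<close>). This is a form of the stability of quasigeodesics, deduced here from
  a chain inequality for the quasi-ultrametric \<open>exp (- \<epsilon> (x | y))\<close>.
\<close>

section \<open>Metrics that are geodesic on a discrete set\<close>

text \<open>Only vertices of a Cayley graph are available as points, so a geodesic from \<open>x\<close> to \<open>y\<close> is
  a sequence of \<open>n + 1\<close> points that is an isometric copy of \<open>{0..n}\<close>; in particular
  \<open>d x y = n\<close>, and distances are integers.\<close>

definition geodesic_path :: "'a set \<Rightarrow> ('a \<Rightarrow> 'a \<Rightarrow> real) \<Rightarrow> (nat \<Rightarrow> 'a) \<Rightarrow> nat \<Rightarrow> 'a \<Rightarrow> 'a \<Rightarrow> bool"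
  where "geodesic_path M d p n x y \<longleftrightarrow> p 0 = x \<and> p n = y \<and> (\<forall>i\<le>n. p i \<in> M) \<and>
    (\<forall>i\<le>n. \<forall>j\<le>n. d (p i) (p j) = \<bar>real i - real j\<bar>)"

locale path_metric =
  fixes M :: "'a set" and d :: "'a \<Rightarrow> 'a \<Rightarrow> real"
  assumes refl: "x \<in> M \<Longrightarrow> d x x = 0"
    and sym: "x \<in> M \<Longrightarrow> y \<in> M \<Longrightarrow> d x y = d y x"
    and triangle: "x \<in> M \<Longrightarrow> y \<in> M \<Longrightarrow> z \<in> M \<Longrightarrow> d x z \<le> d x y + d y z"
    and geodesic: "x \<in> M \<Longrightarrow> y \<in> M \<Longrightarrow> \<exists>p n. geodesic_path M d p n x y"
begin

abbreviation gp :: "'a \<Rightarrow> 'a \<Rightarrow> 'a \<Rightarrow> real"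
  where "gp w x y \<equiv> gromov_product d w x y"

lemma nonneg: "x \<in> M \<Longrightarrow> y \<in> M \<Longrightarrow> 0 \<le> d x y"
  using triangle[of x y x] sym[of x y] refl[of x] by auto

lemma gp_sym: "x \<in> M \<Longrightarrow> y \<in> M \<Longrightarrow> gp w x y = gp w y x"
  using sym[of x y] by (simp add: gromov_product_def)

lemma gp_nonneg: "w \<in> M \<Longrightarrow> x \<in> M \<Longrightarrow> y \<in> M \<Longrightarrow> 0 \<le> gp w x y"
  using triangle[of x w y] sym[of w y] by (simp add: gromov_product_def)

lemma gp_le: "w \<in> M \<Longrightarrow> x \<in> M \<Longrightarrow> y \<in> M \<Longrightarrow> gp w x y \<le> d w x"
  using triangle[of y x w] sym[of x y] sym[of w x] by (simp add: gromov_product_def)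

lemma gp_ge: "w \<in> M \<Longrightarrow> x \<in> M \<Longrightarrow> y \<in> M \<Longrightarrow> d w x - d x y \<le> gp w x y"
  using triangle[of x y w] sym[of w x] by (simp add: gromov_product_def)

lemma gp_base: "w \<in> M \<Longrightarrow> v \<in> M \<Longrightarrow> x \<in> M \<Longrightarrow> y \<in> M \<Longrightarrow> gp w x y \<le> gp v x y + d w v"
  using triangle[of x v w] triangle[of y v w] sym[of w v]
  by (simp add: gromov_product_def diff_divide_distrib add_divide_distrib)

lemma gp_geodesic_le:
  assumes p: "geodesic_path M d p n x y" and "i \<le> n" "w \<in> M"
  shows "gp w x y \<le> d w (p i)"
proof -
  have "x = p 0" "y = p n" "p i \<in> M" "p 0 \<in> M" "p n \<in> M" and
     "d (p 0) (p i) = real i" "d (p n) (p i) = real n - real i" "d (p 0) (p n) = real n"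
    using p \<open>i \<le> n\<close> by (auto simp: geodesic_path_def)
  then show ?thesis
    using triangle[of x "p i" w] triangle[of y "p i" w] sym[of w "p i"] \<open>w \<in> M\<close>
    by (simp add: gromov_product_def)
qed

end

lemma geodesic_path_prefix:
  "geodesic_path M d p n x y \<Longrightarrow> k \<le> n \<Longrightarrow> geodesic_path M d p k x (p k)"
  by (auto simp: geodesic_path_def)

lemma geodesic_path_suffix:
  "geodesic_path M d p n x y \<Longrightarrow> k \<le> n \<Longrightarrow> geodesic_path M d (\<lambda>i. p (k + i)) (n - k) (p k) y"
  by (auto simp: geodesic_path_def)

text \<open>The chain inequality of Frink: a quasi-ultrametric with constant at most \<open>\<surd>2\<close> is, up to the
  factor \<open>2\<close>, bounded by the length of any chain. One cuts the chain at the last index \<open>m\<close> at which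
  the first part carries at most half of the total length \<open>T\<close>. Both outer parts are then at most
  \<open>T / 2\<close>, so induction bounds the distances between their end points by \<open>T\<close>, and two applications of
  the quasi-ultrametric inequality cost \<open>K\<^sup>2 \<le> 2\<close>.\<close>

lemma frink_chain:
  fixes \<rho> :: "nat \<Rightarrow> nat \<Rightarrow> real"
  assumes nonneg: "\<And>i j. 0 \<le> \<rho> i j"
    and K: "1 \<le> K" "K * K \<le> 2"
    and quasi: "\<And>i j k. \<rho> i k \<le> K * max (\<rho> i j) (\<rho> j k)"
    and "a < b"
  shows "\<rho> a b \<le> 2 * (\<Sum>i=a..<b. \<rho> i (Suc i))"
  using \<open>a < b\<close>
proof (induction "b - a" arbitrary: a b rule: less_induct)
  case less
  define s where "s = (\<lambda>a b. \<Sum>i=a..<b. \<rho> i (Suc i))"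
  define T where "T = s a b"
  have s_split: "s i k = s i j + s j k" if "i \<le> j" "j \<le> k" for i j k
    unfolding s_def using that by (simp add: sum.atLeastLessThan_concat)
  have s_nonneg: "0 \<le> s i j" for i j
    unfolding s_def by (simp add: nonneg sum_nonneg)
  define A where "A = {m \<in> {a..<b}. s a m \<le> T / 2}"
  have "finite A" "a \<in> A"
    using less.prems s_nonneg[of a b] by (auto simp: A_def T_def s_def)
  define m where "m = Max A"
  have "m \<in> A"
    unfolding m_def using \<open>finite A\<close> \<open>a \<in> A\<close> by (intro Max_in) auto
  then have m: "a \<le> m" "m < b" "s a m \<le> T / 2"
    by (auto simp: A_def)
  have rest: "s (Suc m) b \<le> T / 2"
  proof (cases "Suc m = b")
    case True
    then show ?thesis using s_nonneg[of a b] by (simp add: s_def T_def)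
  next
    case False
    have "Suc m \<notin> A"
      using Max_ge[OF \<open>finite A\<close>, of "Suc m"] by (auto simp: m_def)
    then have "s a (Suc m) > T / 2"
      using m False by (auto simp: A_def)
    then show ?thesis
      using s_split[of a "Suc m" b] m by (simp add: T_def)
  qed
  have T0: "0 \<le> T" by (simp add: T_def s_nonneg)
  have KT: "T \<le> K * T" using K T0 by (simp add: mult_le_cancel_right1)
  have step: "\<rho> m (Suc m) \<le> T"
    using s_split[of a m b] s_split[of m "Suc m" b] s_nonneg[of a m] s_nonneg[of "Suc m" b] m
    by (simp add: T_def s_def)
  have left: "\<rho> a (Suc m) \<le> K * T"
  proof (cases "a = m")
    case True then show ?thesis using step KT by simp
  next
    case False
    then have "\<rho> a m \<le> 2 * s a m"
      unfolding s_def using m by (intro less.hyps) auto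
    then have "max (\<rho> a m) (\<rho> m (Suc m)) \<le> T" using m step by simp
    then have "K * max (\<rho> a m) (\<rho> m (Suc m)) \<le> K * T" using K by (intro mult_left_mono) auto
    then show ?thesis using quasi[of a "Suc m" m] by linarith
  qed
  have KK: "K * T \<le> 2 * T" 
  proof -
    have "K * 1 \<le> K * K" using K by (intro mult_left_mono) auto
    then have "K \<le> 2" using K by linarith
    then show ?thesis using T0 by (intro mult_right_mono) auto
  qed
  have "\<rho> a b \<le> 2 * T"
  proof (cases "Suc m = b")
    case True then show ?thesis using left KK by simp
  next
    case False
    then have "\<rho> (Suc m) b \<le> 2 * s (Suc m) b"
      unfolding s_def using m by (intro less.hyps) auto
    then have "max (\<rho> a (Suc m)) (\<rho> (Suc m) b) \<le> K * T" using rest left KT by simp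
    then have "K * max (\<rho> a (Suc m)) (\<rho> (Suc m) b) \<le> K * (K * T)" using K by (intro mult_left_mono) auto
    also have "\<dots> \<le> 2 * T" using K(2) T0 by (simp add: mult_right_mono flip: mult.assoc)
    finally show ?thesis using quasi[of a b "Suc m"] by linarith
  qed
  then show ?case by (simp add: T_def s_def)
qed

lemma sum_two_sided_geometric_le:
  fixes r :: real
  assumes "0 < r" "r < 1"
  shows "(\<Sum>i<n. r powr \<bar>real i - real k\<bar>) \<le> 2 / (1 - r)"
proof -
  have g: "(\<Sum>j\<in>A. r ^ j) \<le> 1 / (1 - r)" if "finite A" for A
  proof -
    have "(\<Sum>j\<in>A. r ^ j) \<le> suminf (\<lambda>j. r ^ j)"
      using assms that by (intro sum_le_suminf summable_geometric) auto
    then show ?thesis using assms by (simp add: suminf_geometric)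
  qed
  have split: "{..<n} = {i. i < n \<and> i < k} \<union> {i. i < n \<and> k \<le> i}" by auto
  have "(\<Sum>i<n. r powr \<bar>real i - real k\<bar>) =
     (\<Sum>i\<in>{i. i < n \<and> i < k}. r ^ (k - i)) + (\<Sum>i\<in>{i. i < n \<and> k \<le> i}. r ^ (i - k))"
    unfolding split using assms
    by (subst sum.union_disjoint) (auto simp: powr_realpow[symmetric] of_nat_diff intro!: sum.cong arg_cong2[where f=plus])
  also have "(\<Sum>i\<in>{i. i < n \<and> i < k}. r ^ (k - i)) = (\<Sum>j\<in>(\<lambda>i. k - i) ` {i. i < n \<and> i < k}. r ^ j)"
    by (subst sum.reindex) (auto simp: inj_on_def)
  also have "(\<Sum>i\<in>{i. i < n \<and> k \<le> i}. r ^ (i - k)) = (\<Sum>j\<in>(\<lambda>i. i - k) ` {i. i < n \<and> k \<le> i}. r ^ j)"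
    by (subst sum.reindex) (auto simp: inj_on_def)
  finally show ?thesis
    using g[of "(\<lambda>i. k - i) ` {i. i < n \<and> i < k}"] g[of "(\<lambda>i. i - k) ` {i. i < n \<and> k \<le> i}"] by simp
qed

section \<open>Gromov products of bilipschitz equivalent metrics\<close>

text \<open>The metric \<open>d1\<close> is hyperbolic. A \<open>d2\<close>-geodesic is then a quasigeodesic for \<open>d1\<close>, and the lemmas
  below contain the two halves of the stability of quasigeodesics, phrased with Gromov products for \<open>d1\<close>.
  Points near a \<open>d1\<close>-geodesic from \<open>x\<close> to \<open>y\<close> are those \<open>w\<close> for which \<open>(x | y)\<^sub>w\<close> is small: such
  \<open>w\<close> are close to the quasigeodesic, and all points of the quasigeodesic are such \<open>w\<close>.\<close>

locale bilipschitz_path_metrics =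
  d1: path_metric M d1 + d2: path_metric M d2
  for M :: "'a set" and d1 d2 :: "'a \<Rightarrow> 'a \<Rightarrow> real" +
  fixes L \<delta> :: real
  assumes L: "1 \<le> L" and \<delta>: "0 < \<delta>"
    and d1_le: "x \<in> M \<Longrightarrow> y \<in> M \<Longrightarrow> d1 x y \<le> L * d2 x y"
    and d2_le: "x \<in> M \<Longrightarrow> y \<in> M \<Longrightarrow> d2 x y \<le> L * d1 x y"
    and hyp: "w \<in> M \<Longrightarrow> x \<in> M \<Longrightarrow> y \<in> M \<Longrightarrow> z \<in> M \<Longrightarrow>
       min (d1.gp w x y) (d1.gp w y z) - \<delta> \<le> d1.gp w x z"
begin

text \<open>A point \<open>w\<close> with small \<open>(x | y)\<^sub>w\<close> is close to the quasigeodesic \<open>p\<close>. For suitable \<open>\<epsilon>\<close> the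
  function \<open>exp (- \<epsilon> (a | b)\<^sub>w)\<close> is a quasi-ultrametric with constant \<open>\<surd>2\<close>, so the chain inequality
  applies to the points of \<open>p\<close>. If \<open>D\<close> is the distance from \<open>w\<close> to \<open>p\<close>, attained at index \<open>k\<close>, the
  links of the chain decay geometrically in \<open>\<bar>i - k\<bar>\<close>, because \<open>p\<close> is a quasigeodesic and moves away from
  \<open>p k\<close> at linear speed. The sum over the chain is therefore a constant times \<open>exp (- \<epsilon> D / 3)\<close>,
  whatever the length of \<open>p\<close>.\<close>

lemma point_near_quasigeodesic:
  "\<exists>C\<ge>0. \<forall>p n x y. \<forall>w\<in>M. geodesic_path M d2 p n x y \<longrightarrow>
      (\<exists>k\<le>n. d1 w (p k) \<le> 3 * d1.gp w x y + C)"
proof -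
  \<comment> \<open>This makes \<open>exp (\<epsilon> \<delta>) = \<surd>2\<close>, the constant needed for the chain inequality.\<close>
  define \<epsilon> where "\<epsilon> = ln 2 / (2 * \<delta>)"
  define r where "r = exp (- (\<epsilon> / (3 * L)))"
  define B where "B = 2 * exp (\<epsilon> * L) * (2 / (1 - r))"
  have \<epsilon>: "0 < \<epsilon>" using \<delta> by (simp add: \<epsilon>_def)
  then have r: "0 < r" "r < 1" using L by (auto simp: r_def)
  have "0 < B" using r by (simp add: B_def)
  have key: "\<exists>k\<le>n. d1 w (p k) \<le> 3 * d1.gp w x y + max 0 (3 * ln B / \<epsilon>)"
    if w: "w \<in> M" and p: "geodesic_path M d2 p n x y" for p n x y w
  proof -
    have pM: "p i \<in> M" if "i \<le> n" for i using p that by (simp add: geodesic_path_def)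
    have pxy: "x = p 0" "y = p n" using p by (auto simp: geodesic_path_def)
    have "\<exists>k\<in>{..n}. \<forall>i\<in>{..n}. d1 w (p k) \<le> d1 w (p i)"
      using ex_min_if_finite[of "(\<lambda>i. d1 w (p i)) ` {..n}"] by (auto simp: not_less) 
    then obtain k where k: "k \<le> n" "\<And>i. i \<le> n \<Longrightarrow> d1 w (p k) \<le> d1 w (p i)" by auto
    define D where "D = d1 w (p k)"
    have D0: "0 \<le> D" unfolding D_def using d1.nonneg w pM k by auto
    show ?thesis
    proof (cases "n = 0")
      case True
      then have "d1.gp w x y = D" using k pxy pM[of 0] w d1.refl d1.sym[of w x]
        by (simp add: gromov_product_def D_def)
      then show ?thesis using k D0 by (intro exI[of _ k]) (auto simp: D_def)
    next
      case False
      \<comment> \<open>A weighted mean, with weights \<open>2/3\<close> and \<open>1/3\<close>, of the lower bounds \<open>D\<close> and \<open>\<bar>i - k\<bar> / L - D\<close>; it keeps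
        a positive multiple of both \<open>D\<close> and \<open>\<bar>i - k\<bar>\<close>.\<close>
      have far: "D / 3 + \<bar>real i - real k\<bar> / (3 * L) \<le> d1 w (p i)" if "i \<le> n" for i
      proof -
        have "\<bar>real i - real k\<bar> = d2 (p i) (p k)" using p that k by (simp add: geodesic_path_def)
        also have "\<dots> \<le> L * d1 (p i) (p k)" using d2_le pM that k by auto
        finally have "\<bar>real i - real k\<bar> / L \<le> d1 (p i) (p k)" using L by (simp add: field_simps)
        also have "\<dots> \<le> d1 w (p i) + D"
          unfolding D_def using d1.triangle[of "p i" w "p k"] d1.sym[of w "p i"] pM that k w by auto
        finally have "\<bar>real i - real k\<bar> / L \<le> d1 w (p i) + D" .
        moreover have "\<bar>real i - real k\<bar> / (3 * L) = (\<bar>real i - real k\<bar> / L) / 3" by simp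
        moreover have "D \<le> d1 w (p i)" using k that by (simp add: D_def)
        ultimately show ?thesis by linarith
      qed
      \<comment> \<open>The path is stopped at its end so that the quasi-ultrametric inequality holds for all indices.\<close>
      define q where "q = (\<lambda>i. p (min i n))"
      have qM: "q i \<in> M" for i by (simp add: q_def pM)
      define \<rho> where "\<rho> = (\<lambda>i j. exp (- \<epsilon> * d1.gp w (q i) (q j)))"
      have quasi: "\<rho> i l \<le> exp (\<epsilon> * \<delta>) * max (\<rho> i j) (\<rho> j l)" for i j l
      proof -
        have "- \<epsilon> * d1.gp w (q i) (q l) \<le> - \<epsilon> * (min (d1.gp w (q i) (q j)) (d1.gp w (q j) (q l)) - \<delta>)"
          using hyp[OF w qM qM qM, of i j l] \<epsilon> by (intro mult_left_mono_neg) auto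
        also have "\<dots> = \<epsilon> * \<delta> + max (- \<epsilon> * d1.gp w (q i) (q j)) (- \<epsilon> * d1.gp w (q j) (q l))"
          using \<epsilon> by (auto simp: min_def max_def algebra_simps)
        finally have "\<rho> i l \<le> exp (\<epsilon> * \<delta> + max (- \<epsilon> * d1.gp w (q i) (q j)) (- \<epsilon> * d1.gp w (q j) (q l)))"
          by (simp add: \<rho>_def)
        also have "\<dots> = exp (\<epsilon> * \<delta>) * max (\<rho> i j) (\<rho> j l)"
          by (simp add: exp_add \<rho>_def max_def)
        finally show ?thesis .
      qed
      have "exp (\<epsilon> * \<delta>) * exp (\<epsilon> * \<delta>) = exp (ln 2)"
        unfolding exp_add[symmetric] using \<delta> by (simp add: \<epsilon>_def)
      then have "\<rho> 0 n \<le> 2 * (\<Sum>i=0..<n. \<rho> i (Suc i))"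
        using False quasi \<epsilon> \<delta> by (intro frink_chain[where K = "exp (\<epsilon> * \<delta>)"]) (auto simp: \<rho>_def)
      also have "(\<Sum>i=0..<n. \<rho> i (Suc i)) \<le> (\<Sum>i=0..<n. exp (\<epsilon> * L) * exp (- \<epsilon> * D / 3) * r powr \<bar>real i - real k\<bar>)"
      proof (intro sum_mono)
        fix i assume "i \<in> {0..<n}"
        then have i: "i < n" by simp
        have q: "q i = p i" "q (Suc i) = p (Suc i)" using i by (auto simp: q_def)
        have "d2 (p i) (p (Suc i)) = 1" using p i by (simp add: geodesic_path_def)
        then have "d1 (p i) (p (Suc i)) \<le> L" using d1_le[of "p i" "p (Suc i)"] pM i by auto
        then have "d1 w (p i) - L \<le> d1.gp w (q i) (q (Suc i))"
          using d1.gp_ge[of w "p i" "p (Suc i)"] w pM i unfolding q by auto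
        then have "D / 3 + \<bar>real i - real k\<bar> / (3 * L) - L \<le> d1.gp w (q i) (q (Suc i))"
          using far[of i] i by linarith
        then have "- \<epsilon> * d1.gp w (q i) (q (Suc i)) \<le> - \<epsilon> * (D / 3 + \<bar>real i - real k\<bar> / (3 * L) - L)"
          using \<epsilon> by (intro mult_left_mono_neg) auto
        also have "\<dots> = \<epsilon> * L + - \<epsilon> * D / 3 + \<bar>real i - real k\<bar> * - (\<epsilon> / (3 * L))"
          by (simp add: algebra_simps)
        finally have "\<rho> i (Suc i) \<le> exp (\<epsilon> * L + - \<epsilon> * D / 3 + \<bar>real i - real k\<bar> * - (\<epsilon> / (3 * L)))"
          by (simp add: \<rho>_def)
        also have "\<dots> = exp (\<epsilon> * L) * exp (- \<epsilon> * D / 3) * r powr \<bar>real i - real k\<bar>"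
          by (simp only: exp_add r_def powr_def ln_exp) simp
        finally show "\<rho> i (Suc i) \<le> \<dots>" .
      qed
      also have "\<dots> = exp (\<epsilon> * L) * exp (- \<epsilon> * D / 3) * (\<Sum>i<n. r powr \<bar>real i - real k\<bar>)"
        by (simp add: sum_distrib_left lessThan_atLeast0)
      also have "\<dots> \<le> exp (\<epsilon> * L) * exp (- \<epsilon> * D / 3) * (2 / (1 - r))"
        using sum_two_sided_geometric_le[OF r, where n = n and k = k] by (intro mult_left_mono) auto
      finally have "exp (- \<epsilon> * d1.gp w x y) \<le> B * exp (- \<epsilon> * D / 3)"
        by (simp add: \<rho>_def q_def pxy B_def)
      also have "\<dots> = exp (ln B + - \<epsilon> * D / 3)" unfolding exp_add using \<open>0 < B\<close> by simp
      finally have "- \<epsilon> * d1.gp w x y \<le> ln B + - \<epsilon> * D / 3" by (simp only: exp_le_cancel_iff)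
      then have "\<epsilon> * D \<le> \<epsilon> * (3 * d1.gp w x y + 3 * ln B / \<epsilon>)" using \<epsilon> by (simp add: algebra_simps)
      then have "D \<le> 3 * d1.gp w x y + 3 * ln B / \<epsilon>" using \<epsilon> by (simp only: mult_le_cancel_left_pos)
      then show ?thesis using k by (intro exI[of _ k]) (auto simp: D_def)
    qed
  qed
  then show ?thesis by (intro exI[of _ "max 0 (3 * ln B / \<epsilon>)"]) auto
qed

text \<open>A point \<open>P = p k\<close> of the quasigeodesic has small \<open>R = (x | y)\<^sub>P\<close>. Up to distance \<open>R\<close> from \<open>P\<close> the
  geodesics from \<open>P\<close> to \<open>x\<close> and to \<open>y\<close> run together, so a point \<open>q\<close> at distance \<open>t \<le> R\<close> on the first of
  them is close both to the part of \<open>p\<close> before \<open>P\<close> and to the part after \<open>P\<close>. Those two nearby points of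
  \<open>p\<close> are close to each other, hence so are their indices; as \<open>k\<close> lies between them, \<open>q\<close> is close to \<open>P\<close>,
  which bounds \<open>t\<close>.\<close>

lemma quasigeodesic_near_geodesic:
  "\<exists>C\<ge>0. \<forall>p n x y k. geodesic_path M d2 p n x y \<and> k \<le> n \<longrightarrow> d1.gp (p k) x y \<le> C"
proof -
  obtain C1 where C1: "0 \<le> C1" and near: "\<And>p n x y w. w \<in> M \<Longrightarrow> geodesic_path M d2 p n x y \<Longrightarrow>
      \<exists>k\<le>n. d1 w (p k) \<le> 3 * d1.gp w x y + C1"
    using point_near_quasigeodesic by blast
  \<comment> \<open>\<open>E\<close> bounds the distance between the two points of the path near \<open>q\<close>, so \<open>L E\<close> bounds the difference
    of their indices, and \<open>L (L E)\<close> the distance from \<open>P\<close> to the first of them.\<close>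
  define E where "E = 3 * \<delta> + 2 * C1"
  define C where "C = L * (L * E) + C1"
  have "0 \<le> E" using \<delta> C1 by (simp add: E_def)
  have "0 \<le> C" using C1 L \<open>0 \<le> E\<close> by (simp add: C_def)
  have "d1.gp (p k) x y \<le> C + 1" if p: "geodesic_path M d2 p n x y" and k: "k \<le> n" for p n x y k
  proof -
    have pM: "p i \<in> M" if "i \<le> n" for i using p that by (simp add: geodesic_path_def)
    have pxy: "x = p 0" "y = p n" using p by (auto simp: geodesic_path_def)
    have xy: "x \<in> M" "y \<in> M" using pM unfolding pxy by auto
    define P where "P = p k"
    have P: "P \<in> M" using pM k by (simp add: P_def)
    define R where "R = d1.gp P x y"
    have R0: "0 \<le> R" unfolding R_def using P xy d1.gp_nonneg by auto
    define t where "t = nat \<lfloor>R\<rfloor>"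
    have t: "real t \<le> R" "R \<le> real t + 1" using R0 unfolding t_def by linarith+
    obtain q' m where q': "geodesic_path M d1 q' m P x" using d1.geodesic P xy by blast
    have m: "d1 P x = real m" "q' 0 = P" "q' m = x" using q' by (auto simp: geodesic_path_def)
    have "R \<le> real m" unfolding R_def m(1)[symmetric] using d1.gp_le P xy by auto
    then have tm: "t \<le> m" using t by linarith
    define q where "q = q' t"
    have q: "q \<in> M" "d1 P q = real t" "d1 q P = real t" "d1 q x = real m - real t" "d1 x q = real m - real t"
      using q' tm m(2,3) unfolding q_def geodesic_path_def by force+
    have sP: "d1 x P = real m" "d1 y P = d1 P y" using d1.sym P xy m by auto
    have q_left: "d1.gp q x P = 0"
      using q sP by (simp add: gromov_product_def)
    have "d1.gp P q x = real t" using q sP m by (simp add: gromov_product_def)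
    then have "real t - \<delta> \<le> d1.gp P q y"
      using hyp[OF P q(1) xy] t unfolding R_def[symmetric] by simp
    then have q_right: "d1.gp q P y \<le> \<delta>"
      using q sP d1.sym[of q y] xy by (simp add: gromov_product_def)
    obtain i where i: "i \<le> k" "d1 q (p i) \<le> C1"
      using near[OF q(1) geodesic_path_prefix[OF p k]] q_left by (auto simp: P_def)
    obtain j where j: "j \<le> n - k" "d1 q (p (k + j)) \<le> 3 * \<delta> + C1"
      using near[OF q(1) geodesic_path_suffix[OF p k]] q_right by (force simp: P_def)
    have ij: "p i \<in> M" "p (k + j) \<in> M" "i \<le> n" "k + j \<le> n" using i j k pM by auto
    have "real (k + j) - real i = d2 (p i) (p (k + j))" using p ij i by (simp add: geodesic_path_def)
    also have "\<dots> \<le> L * d1 (p i) (p (k + j))" using d2_le ij by auto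
    also have "\<dots> \<le> L * E"
      using d1.triangle[of "p i" q "p (k + j)"] d1.sym[of q "p i"] ij q i j L
      by (intro mult_left_mono) (auto simp: E_def)
    finally have ki: "real k - real i \<le> L * E" by simp
    have "d1 P (p i) \<le> L * d2 P (p i)" using d1_le P ij by auto
    also have "d2 P (p i) = real k - real i" using p k i by (simp add: geodesic_path_def P_def)
    also have "L * \<dots> \<le> L * (L * E)" using ki L by (intro mult_left_mono) auto
    finally have "d1 P q \<le> C" 
      using d1.triangle[of P "p i" q] d1.sym[of q "p i"] P ij q i by (simp add: C_def)
    then show ?thesis using t q unfolding P_def[symmetric] R_def[symmetric] by linarith
  qed
  then show ?thesis using \<open>0 \<le> C\<close> by (intro exI[of _ "C + 1"]) auto
qed

text \<open>The product \<open>(x | y)\<^sub>w\<close> for \<open>d1\<close> is comparable to the distance from \<open>w\<close> to a \<open>d2\<close>-geodesic \<open>p\<close> from \<open>x\<close>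
  to \<open>y\<close>, and this distance dominates the product for \<open>d2\<close>, which gives the first inequality. For the
  second, \<open>d2\<close>-geodesic triangles with vertices \<open>w\<close>, \<open>x\<close>, \<open>y\<close> are thin. Moving along \<open>p\<close> there is a place
  where one changes from being near the side \<open>w x\<close> to being near the side \<open>w y\<close>; at a point near both sides,
  the triangle is almost a tripod for \<open>d2\<close>, so \<open>(x | y)\<^sub>w\<close> for \<open>d2\<close> is almost the \<open>d2\<close>-distance
  from \<open>w\<close> to that point.\<close>

lemma gromov_products_comparable:
  "\<exists>c>0. \<exists>C. \<forall>w\<in>M. \<forall>x\<in>M. \<forall>y\<in>M.
     d1.gp w x y \<ge> c * d2.gp w x y - C \<and> d2.gp w x y \<ge> c * d1.gp w x y - C"
proof -
  obtain C1 where C1: "0 \<le> C1" and near: "\<And>p n x y w. w \<in> M \<Longrightarrow> geodesic_path M d2 p n x y \<Longrightarrow>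
      \<exists>k\<le>n. d1 w (p k) \<le> 3 * d1.gp w x y + C1"
    using point_near_quasigeodesic by blast
  obtain C2 where C2: "0 \<le> C2" and on: "\<And>p n x y k. geodesic_path M d2 p n x y \<Longrightarrow> k \<le> n \<Longrightarrow> d1.gp (p k) x y \<le> C2"
    using quasigeodesic_near_geodesic by blast
  define C3 where "C3 = 3 * (C2 + \<delta>) + C1"
  define E where "E = L * (C3 + L)"
  define c where "c = 1 / (3 * L)"
  have C3: "0 \<le> C3" using C1 C2 \<delta> by (simp add: C3_def)
  have lower: "d1.gp w x y \<ge> c * d2.gp w x y - (C1 + C2 + 2 * E)"
    if w: "w \<in> M" and xy: "x \<in> M" "y \<in> M" for w x y
  proof -
    obtain p n where p: "geodesic_path M d2 p n x y" using d2.geodesic xy by blast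
    obtain k where k: "k \<le> n" "d1 w (p k) \<le> 3 * d1.gp w x y + C1" using near[OF w p] by blast
    have "p k \<in> M" using p k by (auto simp: geodesic_path_def)
    have "d2.gp w x y \<le> d2 w (p k)" using d2.gp_geodesic_le p k w by auto
    also have "\<dots> \<le> L * d1 w (p k)" using d2_le w \<open>p k \<in> M\<close> by auto
    also have "\<dots> \<le> L * (3 * d1.gp w x y + C1)" using k L by (intro mult_left_mono) auto
    finally have "d2.gp w x y / L \<le> 3 * d1.gp w x y + C1" using L by (simp add: pos_divide_le_eq mult.commute)
    then have "c * d2.gp w x y \<le> d1.gp w x y + C1 / 3"
      using divide_right_mono[of "d2.gp w x y / L" "3 * d1.gp w x y + C1" 3]
      by (simp add: c_def mult.commute add_divide_distrib)
    moreover have "0 \<le> E" using C3 L by (simp add: E_def)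
    ultimately show ?thesis using C2 C1 by linarith
  qed
  have upper: "d2.gp w x y \<ge> c * d1.gp w x y - (C1 + C2 + 2 * E)"
    if w: "w \<in> M" and xy: "x \<in> M" "y \<in> M" for w x y
  proof -
    obtain p n where p: "geodesic_path M d2 p n x y" using d2.geodesic xy by blast
    obtain u l where u: "geodesic_path M d2 u l w x" using d2.geodesic xy w by blast
    obtain v m where v: "geodesic_path M d2 v m w y" using d2.geodesic xy w by blast
    have pM: "p i \<in> M" if "i \<le> n" for i using p that by (simp add: geodesic_path_def)
    have uM: "u i \<in> M" if "i \<le> l" for i using u that by (simp add: geodesic_path_def)
    have vM: "v i \<in> M" if "i \<le> m" for i using v that by (simp add: geodesic_path_def)
    define P where "P = (\<lambda>i. \<exists>j\<le>l. d1 (p i) (u j) \<le> C3)"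
    define Q where "Q = (\<lambda>i. \<exists>j\<le>m. d1 (p i) (v j) \<le> C3)"
    have PQ: "P i \<or> Q i" if "i \<le> n" for i
    proof -
      have pi: "p i \<in> M" using pM that by auto
      have "min (d1.gp (p i) x w) (d1.gp (p i) w y) \<le> C2 + \<delta>"
        using hyp[OF pi xy(1) w xy(2)] on[OF p that] by linarith
      then consider "d1.gp (p i) w x \<le> C2 + \<delta>" | "d1.gp (p i) w y \<le> C2 + \<delta>"
        using d1.gp_sym w xy by (auto simp: min_le_iff_disj)
      then show ?thesis
      proof cases
        case 1 then show ?thesis using near[OF pi u] by (force simp: P_def C3_def)
      next
        case 2 then show ?thesis using near[OF pi v] by (force simp: Q_def C3_def)
      qed
    qed
    have ends: "p 0 = u l" "p n = v m" using p u v by (auto simp: geodesic_path_def)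
    have "P 0" unfolding P_def using ends d1.refl[of "u l"] uM[of l] C3 by (intro exI[of _ l]) auto
    have "Q n" unfolding Q_def using ends d1.refl[of "v m"] vM[of m] C3 by (intro exI[of _ m]) auto
    \<comment> \<open>The last index near the side \<open>w x\<close>; the next one, if any, must be near the side \<open>w y\<close>.\<close>
    define i where "i = (GREATEST i. i \<le> n \<and> P i)"
    have i: "i \<le> n" "P i" 
      using GreatestI_nat[of "\<lambda>i. i \<le> n \<and> P i" 0 n] \<open>P 0\<close> by (auto simp: i_def)
    have next_Q: "Q i \<or> Suc i \<le> n \<and> Q (Suc i)"
    proof (cases "i = n")
      case True then show ?thesis using \<open>Q n\<close> by simp
    next
      case False
      then have "\<not> P (Suc i)"
        using Greatest_le_nat[of "\<lambda>i. i \<le> n \<and> P i" "Suc i" n] i by (auto simp: i_def[symmetric])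
      then show ?thesis using PQ[of "Suc i"] i False by auto
    qed
    obtain j where j: "j \<le> l" "d1 (p i) (u j) \<le> C3" using i by (auto simp: P_def)
    obtain h where h: "h \<le> m" "d1 (p i) (v h) \<le> C3 + L"
    proof (cases "Q i")
      case True then show ?thesis using that L by (force simp: Q_def)
    next
      case False
      then obtain h where h: "Suc i \<le> n" "h \<le> m" "d1 (p (Suc i)) (v h) \<le> C3"
        using next_Q by (auto simp: Q_def)
      have "d2 (p i) (p (Suc i)) = 1" using p h by (simp add: geodesic_path_def)
      then have "d1 (p i) (p (Suc i)) \<le> L" using d1_le[of "p i" "p (Suc i)"] pM h i by auto
      then show ?thesis using that[of h] h d1.triangle[of "p i" "p (Suc i)" "v h"] pM i vM by force
    qed
    have E1: "d2 (p i) (u j) \<le> E" 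
    proof -
      have "L * d1 (p i) (u j) \<le> E" unfolding E_def using j L by (intro mult_left_mono) auto
      then show ?thesis using d2_le[of "p i" "u j"] pM uM i j by force
    qed
    have E2: "d2 (p i) (v h) \<le> E" 
    proof -
      have "L * d1 (p i) (v h) \<le> E" unfolding E_def using h L by (intro mult_left_mono) auto
      then show ?thesis using d2_le[of "p i" "v h"] pM vM i h by force
    qed
    have mem: "p i \<in> M" "u j \<in> M" "v h \<in> M" using pM uM vM i j h by auto
    have x: "d2 w x = d2 w (u j) + d2 (u j) x" using u j by (auto simp: geodesic_path_def)
    have y: "d2 w y = d2 w (v h) + d2 (v h) y" using v h by (auto simp: geodesic_path_def)
    have z: "d2 x y = d2 x (p i) + d2 (p i) y" using p i by (auto simp: geodesic_path_def)
    have "d2 w (p i) \<le> d2 w (u j) + E" "d2 w (p i) \<le> d2 w (v h) + E"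
      using d2.triangle[of w "u j" "p i"] d2.triangle[of w "v h" "p i"]
        d2.sym[of "u j" "p i"] d2.sym[of "v h" "p i"] E1 E2 mem w by auto
    moreover have "d2 x (p i) \<le> d2 (u j) x + E" "d2 (p i) y \<le> d2 (v h) y + E"
      using d2.triangle[of "p i" "u j" x] d2.triangle[of "p i" "v h" y] d2.sym[of x "p i"] 
        E1 E2 mem xy by auto
    ultimately have A: "d2 w (p i) - 2 * E \<le> d2.gp w x y"
      using x y z d2.sym[of w x] d2.sym[of w y] w xy by (simp add: gromov_product_def)
    have "d1.gp w x y \<le> d1.gp (p i) x y + d1 w (p i)" using d1.gp_base mem w xy by auto
    also have "\<dots> \<le> C2 + L * d2 w (p i)" using on[OF p i(1)] d1_le[of w "p i"] mem w by auto
    finally have "d1.gp w x y - C2 \<le> d2 w (p i) * L" by (simp add: mult.commute)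
    moreover have "0 \<le> d2 w (p i) * L" using d2.nonneg[of w "p i"] mem w L by simp
    ultimately have "d1.gp w x y - C2 \<le> d2 w (p i) * (3 * L)" by linarith
    then have "(d1.gp w x y - C2) / (3 * L) \<le> d2 w (p i)" using L by (simp add: pos_divide_le_eq)
    moreover have "(d1.gp w x y - C2) / (3 * L) = c * d1.gp w x y - C2 / (3 * L)" by (simp add: c_def diff_divide_distrib)
    moreover have "C2 / (3 * L) \<le> C2" using divide_left_mono[of 1 "3*L" C2] C2 L by simp
    ultimately show ?thesis using A C1 by linarith
  qed
  show ?thesis
    using lower upper L by (intro exI[of _ c] conjI exI[of _ "C1 + C2 + 2 * E"]) (auto simp: c_def)
qed

end

section \<open>Word metrics\<close>

lemma (in group) cancel_inv_left: "x \<in> carrier G \<Longrightarrow> y \<in> carrier G \<Longrightarrow> inv x \<otimes> (x \<otimes> y) = y"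
  by (simp flip: m_assoc)

lemma (in group) cancel_inv_right: "x \<in> carrier G \<Longrightarrow> y \<in> carrier G \<Longrightarrow> x \<otimes> (inv x \<otimes> y) = y"
  by (simp flip: m_assoc)

locale finitely_generated_group = group G for G (structure) +
  fixes S
  assumes gen: "finite_generating_set G S"
begin

abbreviation len :: "'a \<Rightarrow> nat" where "len \<equiv> word_length G S"
abbreviation dS :: "'a \<Rightarrow> 'a \<Rightarrow> real" where "dS \<equiv> word_dist G S"
abbreviation letters :: "'a set" where "letters \<equiv> S \<union> m_inv G ` S"
abbreviation word_value :: "'a list \<Rightarrow> 'a" where "word_value ws \<equiv> foldr (\<otimes>) ws \<one>"

lemma letters_carrier: "letters \<subseteq> carrier G"
  using gen by (auto simp: finite_generating_set_def)

lemma word_value_closed: "set ws \<subseteq> letters \<Longrightarrow> word_value ws \<in> carrier G"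
proof (induction ws)
  case (Cons s ws)
  then have "s \<in> carrier G" using letters_carrier by auto
  then show ?case using Cons by simp
qed simp

lemma word_value_append:
  "set us \<subseteq> letters \<Longrightarrow> set vs \<subseteq> letters \<Longrightarrow> word_value (us @ vs) = word_value us \<otimes> word_value vs"
proof (induction us)
  case (Cons s us)
  then have "s \<in> carrier G" "word_value us \<in> carrier G" using letters_carrier word_value_closed[of us] by auto
  then show ?case using Cons word_value_closed[of vs] by (simp add: m_assoc)
qed (simp add: word_value_closed)

lemma word_exists: "g \<in> carrier G \<Longrightarrow> \<exists>ws. set ws \<subseteq> letters \<and> word_value ws = g"
proof -
  assume "g \<in> carrier G"
  then have "g \<in> generate G S" using gen by (simp add: finite_generating_set_def)
  then show ?thesis
  proof induction
    case one
    show ?case by (intro exI[of _ "[]"]) auto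
  next
    case (incl h)
    then show ?case using letters_carrier by (intro exI[of _ "[h]"]) auto
  next
    case (inv h)
    then show ?case using letters_carrier by (intro exI[of _ "[inv h]"]) auto
  next
    case (eng h1 h2)
    then obtain us vs where "set us \<subseteq> letters" "word_value us = h1" "set vs \<subseteq> letters" "word_value vs = h2"
      by auto
    then show ?case using word_value_append[of us vs] by (intro exI[of _ "us @ vs"]) auto
  qed
qed

lemma len_word: "g \<in> carrier G \<Longrightarrow> \<exists>ws. set ws \<subseteq> letters \<and> length ws = len g \<and> word_value ws = g"
proof -
  assume "g \<in> carrier G"
  then have "\<exists>n ws. set ws \<subseteq> letters \<and> length ws = n \<and> word_value ws = g" using word_exists by simp
  then show ?thesis unfolding word_length_def by (rule LeastI_ex)
qed

lemma len_le: "set ws \<subseteq> letters \<Longrightarrow> len (word_value ws) \<le> length ws"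
  unfolding word_length_def by (intro Least_le) auto

lemma len_one: "len \<one> = 0"
  using len_le[of "[]"] by simp

lemma len_mult: "g \<in> carrier G \<Longrightarrow> h \<in> carrier G \<Longrightarrow> len (g \<otimes> h) \<le> len g + len h"
  using len_word[of g] len_word[of h] len_le word_value_append
  by (metis Un_subset_iff length_append set_append)

lemma inv_letter: "s \<in> letters \<Longrightarrow> inv s \<in> letters"
  using gen by (force simp: finite_generating_set_def)

lemma word_value_inv:
  "set ws \<subseteq> letters \<Longrightarrow> word_value (rev (map (m_inv G) ws)) = inv (word_value ws)"
proof (induction ws)
  case (Cons s ws)
  have s: "s \<in> carrier G" "inv s \<in> letters" and ws: "set ws \<subseteq> letters"
    using Cons.prems letters_carrier inv_letter by auto
  have "set (rev (map (m_inv G) ws)) \<subseteq> letters" using ws inv_letter by auto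
  then have "word_value (rev (map (m_inv G) (s # ws))) = word_value (rev (map (m_inv G) ws)) \<otimes> word_value [inv s]"
    using word_value_append[of "rev (map (m_inv G) ws)" "[inv s]"] s by simp
  also have "\<dots> = inv (word_value (s # ws))"
    using Cons.IH[OF ws] s word_value_closed[OF ws] by (simp add: inv_mult_group)
  finally show ?case .
qed simp

lemma len_inv_le: "g \<in> carrier G \<Longrightarrow> len (inv g) \<le> len g"
proof -
  assume "g \<in> carrier G"
  then obtain ws where ws: "set ws \<subseteq> letters" "length ws = len g" "word_value ws = g" using len_word by blast
  then have "set (rev (map (m_inv G) ws)) \<subseteq> letters" using inv_letter by auto
  then show ?thesis using len_le[of "rev (map (m_inv G) ws)"] word_value_inv[OF ws(1)] ws by simp
qed

lemma len_inv: "g \<in> carrier G \<Longrightarrow> len (inv g) = len g"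
  using len_inv_le[of g] len_inv_le[of "inv g"] by simp

lemma finite_ball: "finite {g \<in> carrier G. len g \<le> n}"
proof (rule finite_subset)
  have "finite letters" using gen by (auto simp: finite_generating_set_def)
  then show "finite (word_value ` {ws. set ws \<subseteq> letters \<and> length ws \<le> n})"
    by (intro finite_imageI finite_lists_length_le)
  show "{g \<in> carrier G. len g \<le> n} \<subseteq> word_value ` {ws. set ws \<subseteq> letters \<and> length ws \<le> n}"
    using len_word by (force simp: image_iff)
qed

lemma finite_real_ball: "finite {g \<in> carrier G. real (len g) \<le> r}"
  by (rule finite_subset[OF _ finite_ball[of "nat \<lfloor>r\<rfloor>"]]) (auto simp: le_nat_iff le_floor_iff)

lemma dist_mult_left: "g \<in> carrier G \<Longrightarrow> x \<in> carrier G \<Longrightarrow> y \<in> carrier G \<Longrightarrow> dS (g \<otimes> x) (g \<otimes> y) = dS x y"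
  by (simp add: word_dist_def inv_mult_group m_assoc cancel_inv_left cancel_inv_right)

lemma dist_one: "x \<in> carrier G \<Longrightarrow> dS \<one> x = len x"
  by (simp add: word_dist_def)

lemma dist_one_right: "x \<in> carrier G \<Longrightarrow> dS x \<one> = len x"
  by (simp add: word_dist_def len_inv)

lemma word_path_metric: "path_metric (carrier G) dS"
proof
  show "dS x x = 0" if "x \<in> carrier G" for x using that by (simp add: word_dist_def len_one)
  show sym: "dS x y = dS y x" if "x \<in> carrier G" "y \<in> carrier G" for x y
    using that len_inv[of "inv x \<otimes> y"] by (simp add: word_dist_def inv_mult_group)
  show tri: "dS x z \<le> dS x y + dS y z" if "x \<in> carrier G" "y \<in> carrier G" "z \<in> carrier G" for x y z
  proof -
    have "inv x \<otimes> z = (inv x \<otimes> y) \<otimes> (inv y \<otimes> z)" using that by (simp add: m_assoc cancel_inv_left cancel_inv_right)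
    then show ?thesis using len_mult[of "inv x \<otimes> y" "inv y \<otimes> z"] that by (simp add: word_dist_def)
  qed
  show "\<exists>p n. geodesic_path (carrier G) dS p n x y" if x: "x \<in> carrier G" and y: "y \<in> carrier G" for x y
  proof -
    define n where "n = len (inv x \<otimes> y)"
    obtain ws where ws: "set ws \<subseteq> letters" "length ws = n" "word_value ws = inv x \<otimes> y"
      using len_word[of "inv x \<otimes> y"] x y by (auto simp: n_def)
    define p where "p = (\<lambda>i. x \<otimes> word_value (take i ws))"
    have sub: "set (take i ws) \<subseteq> letters" for i using ws set_take_subset[of i ws] by auto
    have pM: "p i \<in> carrier G" for i using x word_value_closed[OF sub] by (simp add: p_def)
    have le: "dS (p i) (p j) \<le> real j - real i" if "i \<le> j" "j \<le> n" for i j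
    proof -
      have sub2: "set (take (j - i) (drop i ws)) \<subseteq> letters"
        using ws by (meson dual_order.trans set_drop_subset set_take_subset)
      have "take j ws = take i ws @ take (j - i) (drop i ws)"
        using that by (metis le_add_diff_inverse take_add)
      then have "p j = p i \<otimes> word_value (take (j - i) (drop i ws))"
        using x word_value_append[OF sub sub2] word_value_closed[OF sub] word_value_closed[OF sub2]
        by (simp add: p_def m_assoc)
      then have "inv (p i) \<otimes> p j = word_value (take (j - i) (drop i ws))"
        using pM[of i] word_value_closed[OF sub2] by (simp add: m_assoc cancel_inv_left cancel_inv_right)
      then show ?thesis using len_le[OF sub2] that ws by (simp add: word_dist_def)
    qed
    have ends: "p 0 = x" "p n = y" using x y ws by (simp_all add: p_def cancel_inv_right)
    have total: "dS (p 0) (p n) = real n" unfolding ends by (simp add: word_dist_def n_def)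
    have eq: "dS (p i) (p j) = real j - real i" if "i \<le> j" "j \<le> n" for i j
      using le[OF that] le[of 0 i] le[of j n] that total tri[of "p 0" "p i" "p n", OF pM pM pM] tri[of "p i" "p j" "p n", OF pM pM pM] by linarith
    have "dS (p i) (p j) = \<bar>real i - real j\<bar>" if "i \<le> n" "j \<le> n" for i j
      using eq[of i j] eq[of j i] sym[OF pM pM, of i j] that by (cases "i \<le> j") auto
    then have "geodesic_path (carrier G) dS p n x y"
      using ends pM by (simp add: geodesic_path_def)
    then show ?thesis by blast
  qed
qed

sublocale W: path_metric "carrier G" dS
  by (rule word_path_metric)

lemma gp_mult_left:
  "g \<in> carrier G \<Longrightarrow> w \<in> carrier G \<Longrightarrow> x \<in> carrier G \<Longrightarrow> y \<in> carrier G \<Longrightarrow> 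
    W.gp (g \<otimes> w) (g \<otimes> x) (g \<otimes> y) = W.gp w x y"
  by (simp add: gromov_product_def dist_mult_left)

text \<open>A homomorphism is Lipschitz for word metrics. With the identity as \<open>f\<close> this compares two
  generating sets; with \<open>f\<close> and its inverse it shows that automorphisms are bilipschitz.\<close>

lemma hom_len_le:
  assumes "finitely_generated_group G T" and f: "f \<in> hom G G"
  shows "\<exists>L. \<forall>g\<in>carrier G. real (len (f g)) \<le> L * real (word_length G T g)"
proof -
  interpret T: finitely_generated_group G T by fact
  interpret f: group_hom G G f using f is_group by (simp add: group_hom_def group_hom_axioms_def)
  define L where "L = (\<Sum>t\<in>T.letters. real (len (f t)))"
  have fin: "finite T.letters" using T.gen by (auto simp: finite_generating_set_def)
  have "real (len (f (T.word_value ws))) \<le> L * real (length ws)" if "set ws \<subseteq> T.letters" for ws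
    using that
  proof (induction ws)
    case Nil then show ?case using len_one by simp
  next
    case (Cons t ws)
    have "t \<in> T.letters" "t \<in> carrier G" "T.word_value ws \<in> carrier G" 
      using Cons.prems T.letters_carrier T.word_value_closed by auto
    moreover have "real (len (f t)) \<le> L"
      unfolding L_def using \<open>t \<in> T.letters\<close> fin by (intro member_le_sum) auto
    moreover have "real (len (f (T.word_value ws))) \<le> L * real (length ws)" using Cons by simp
    ultimately show ?case using len_mult[of "f t" "f (T.word_value ws)"] by (simp add: algebra_simps)
  qed
  then show ?thesis using T.len_word by metis
qed

end

section \<open>Automorphisms and changes of generators preserve Gromov convergence\<close>

text \<open>Increasing \<open>\<delta>\<close> preserves the inequality, so it may be taken positive, which allows
  division by \<open>\<delta>\<close>.\<close>

locale hyperbolic_word_metric = finitely_generated_group G S for G (structure) and S +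
  fixes \<delta> :: real
  assumes \<delta>: "0 < \<delta>"
    and hyp: "w \<in> carrier G \<Longrightarrow> x \<in> carrier G \<Longrightarrow> y \<in> carrier G \<Longrightarrow> z \<in> carrier G \<Longrightarrow>
       min (W.gp w x y) (W.gp w y z) - \<delta> \<le> W.gp w x z"

lemma hyperbolic_group_imp_hyperbolic_word_metric:
  assumes "hyperbolic_group G"
  shows "\<exists>S \<delta>. hyperbolic_word_metric G S \<delta>"
proof -
  obtain S \<delta> where "group G" "finite_generating_set G S" and *:
    "\<forall>w\<in>carrier G. \<forall>x\<in>carrier G. \<forall>y\<in>carrier G. \<forall>z\<in>carrier G.
       gromov_product (word_dist G S) w x z \<ge>
        min (gromov_product (word_dist G S) w x y) (gromov_product (word_dist G S) w y z) - \<delta>"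
    using assms unfolding hyperbolic_group_def gromov_hyperbolic_def by blast
  moreover have "min a b - max 1 \<delta> \<le> c" if "min a b - \<delta> \<le> c" for a b c :: real
    using that by linarith
  ultimately have "hyperbolic_word_metric G S (max 1 \<delta>)"
    unfolding hyperbolic_word_metric_def finitely_generated_group_def hyperbolic_word_metric_axioms_def
      finitely_generated_group_axioms_def by simp
  then show ?thesis by blast
qed

text \<open>The word metric of \<open>T\<close> pulled back along \<open>f\<close> is a path metric that is bilipschitz to the word
  metric of \<open>S\<close>. Taking \<open>f\<close> to be the identity handles a change of generators, taking \<open>T = S\<close> handles
  automorphisms; only the word metric of \<open>S\<close> has to be hyperbolic.\<close>

lemma (in hyperbolic_word_metric) products_comparable_of_automorphism:
  assumes T: "finitely_generated_group G T" and f: "f \<in> hom G G" "bij_betw f (carrier G) (carrier G)"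
  shows "\<exists>c>0. \<exists>C. \<forall>w\<in>carrier G. \<forall>x\<in>carrier G. \<forall>y\<in>carrier G.
     gromov_product dS w x y \<ge> c * gromov_product (word_dist G T) (f w) (f x) (f y) - C \<and>
     gromov_product (word_dist G T) (f w) (f x) (f y) \<ge> c * gromov_product dS w x y - C"
proof -
  interpret T: finitely_generated_group G T by fact
  define d2 where "d2 = (\<lambda>x y. word_dist G T (f x) (f y))"
  interpret f: group_hom G G f using f is_group by (simp add: group_hom_def group_hom_axioms_def)
  define f' where "f' = inv_into (carrier G) f"
  have f': "f' x \<in> carrier G" "f (f' x) = x" if "x \<in> carrier G" for x
    using that f(2) unfolding f'_def by (auto simp: bij_betw_def inv_into_into f_inv_into_f)
  have f'f: "f' (f x) = x" if "x \<in> carrier G" for x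
    using that f(2) unfolding f'_def by (simp add: bij_betw_def)
  have f'_hom: "f' \<in> hom G G"
  proof (rule homI)
    fix x y assume xy: "x \<in> carrier G" "y \<in> carrier G"
    then have "f' (x \<otimes> y) = f' (f (f' x \<otimes> f' y))" using f' by simp
    also have "\<dots> = f' x \<otimes> f' y" using f' xy by (intro f'f) auto
    finally show "f' (x \<otimes> y) = f' x \<otimes> f' y" .
  qed (use f' in auto)
  obtain L1 where L1: "\<And>g. g \<in> carrier G \<Longrightarrow> real (T.len (f g)) \<le> L1 * real (len g)"
    using T.hom_len_le[OF finitely_generated_group_axioms f(1)] by blast
  obtain L2 where L2: "\<And>g. g \<in> carrier G \<Longrightarrow> real (len (f' g)) \<le> L2 * real (T.len g)"
    using hom_len_le[OF T f'_hom] by blast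
  define L where "L = max 1 (max L1 L2)"
  have L: "L1 \<le> L" "L2 \<le> L" "1 \<le> L" by (auto simp: L_def)
  have d2: "d2 x y = real (T.len (f (inv x \<otimes> y)))" if "x \<in> carrier G" "y \<in> carrier G" for x y
    using that by (simp add: d2_def word_dist_def)
  interpret B: bilipschitz_path_metrics "carrier G" dS d2 L \<delta>
  proof
    show "d2 x x = 0" if "x \<in> carrier G" for x
      using that T.W.refl by (simp add: d2_def)
    show "d2 x y = d2 y x" if "x \<in> carrier G" "y \<in> carrier G" for x y
      using that T.W.sym by (simp add: d2_def)
    show "d2 x z \<le> d2 x y + d2 y z" if "x \<in> carrier G" "y \<in> carrier G" "z \<in> carrier G" for x y z
      using that T.W.triangle by (simp add: d2_def)
    show "\<exists>p n. geodesic_path (carrier G) d2 p n x y" if "x \<in> carrier G" "y \<in> carrier G" for x y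
    proof -
      obtain p n where "geodesic_path (carrier G) T.dS p n (f x) (f y)"
        using T.W.geodesic f.hom_closed \<open>x \<in> carrier G\<close> \<open>y \<in> carrier G\<close> by meson
      then have "geodesic_path (carrier G) d2 (\<lambda>i. f' (p i)) n x y"
        using that f' f'f by (simp add: geodesic_path_def d2_def)
      then show ?thesis by blast
    qed
    show "1 \<le> L" "0 < \<delta>" using L \<delta> by auto
    show "dS x y \<le> L * d2 x y" if "x \<in> carrier G" "y \<in> carrier G" for x y
    proof -
      have "dS x y = real (len (f' (f (inv x \<otimes> y))))" using that f'f[of "inv x \<otimes> y"] by (simp add: word_dist_def)
      also have "\<dots> \<le> L2 * d2 x y" using that L2[of "f (inv x \<otimes> y)"] d2 by simp
      also have "\<dots> \<le> L * d2 x y" using L that d2 by (intro mult_right_mono) auto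
      finally show ?thesis .
    qed
    show "d2 x y \<le> L * dS x y" if "x \<in> carrier G" "y \<in> carrier G" for x y
    proof -
      have "d2 x y \<le> L1 * dS x y" using that L1[of "inv x \<otimes> y"] d2 by (simp add: word_dist_def)
      also have "\<dots> \<le> L * dS x y" using L that by (intro mult_right_mono) (auto simp: word_dist_def)
      finally show ?thesis .
    qed
    show "min (W.gp w x y) (W.gp w y z) - \<delta> \<le> W.gp w x z"
      if "w \<in> carrier G" "x \<in> carrier G" "y \<in> carrier G" "z \<in> carrier G" for w x y z
      using hyp that by blast
  qed
  have "gromov_product d2 w x y = gromov_product (word_dist G T) (f w) (f x) (f y)" for w x y
    by (simp add: gromov_product_def d2_def)
  then show ?thesis using B.gromov_products_comparable by simp
qed

lemma tends_to_infinity_iff: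
  fixes F :: "nat \<Rightarrow> nat \<Rightarrow> real"
  shows "filterlim (\<lambda>(i, j). F i j) at_top (sequentially \<times>\<^sub>F sequentially) \<longleftrightarrow>
    (\<forall>R. \<exists>N. \<forall>i\<ge>N. \<forall>j\<ge>N. R \<le> F i j)"
  unfolding filterlim_at_top eventually_prod_sequentially split_conv by blast

lemma tends_to_infinity_comparison:
  fixes F H :: "nat \<Rightarrow> nat \<Rightarrow> real"
  assumes "\<forall>R. \<exists>N. \<forall>i\<ge>N. \<forall>j\<ge>N. R \<le> F i j" and "0 < c" and "\<And>i j. H i j \<ge> c * F i j - C"
  shows "\<forall>R. \<exists>N. \<forall>i\<ge>N. \<forall>j\<ge>N. R \<le> H i j"
proof
  fix R
  obtain N where N: "\<And>i j. i \<ge> N \<Longrightarrow> j \<ge> N \<Longrightarrow> (R + C) / c \<le> F i j" using assms(1) by meson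
  have "R \<le> H i j" if "i \<ge> N" "j \<ge> N" for i j
    using N[OF that] assms(2) assms(3)[of i j] by (simp add: field_simps)
  then show "\<exists>N. \<forall>i\<ge>N. \<forall>j\<ge>N. R \<le> H i j" by blast
qed

section \<open>The boundary and the action of the automorphism group\<close>

context hyperbolic_word_metric
begin

definition converge_together :: "(nat \<Rightarrow> 'a) \<Rightarrow> (nat \<Rightarrow> 'a) \<Rightarrow> bool"
  where "converge_together x y \<longleftrightarrow> (\<forall>R. \<exists>N. \<forall>i\<ge>N. \<forall>j\<ge>N. R \<le> W.gp \<one> (x i) (y j))"

lemma gromov_seqs_iff: "x \<in> gromov_seqs G S \<longleftrightarrow> range x \<subseteq> carrier G \<and> converge_together x x"
  unfolding gromov_seqs_def mem_Collect_eq tends_to_infinity_iff converge_together_def ..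

lemma boundary_rel_iff:
  "(x, y) \<in> boundary_rel G S \<longleftrightarrow> x \<in> gromov_seqs G S \<and> y \<in> gromov_seqs G S \<and> converge_together x y"
  unfolding boundary_rel_def mem_Collect_eq split_conv tends_to_infinity_iff converge_together_def ..

lemma gromov_seq_closed: "x \<in> gromov_seqs G S \<Longrightarrow> x i \<in> carrier G"
  by (auto simp: gromov_seqs_iff)

lemma converge_together_trans:
  assumes x: "\<And>i. x i \<in> carrier G" "\<And>i. y i \<in> carrier G" "\<And>i. z i \<in> carrier G"
    and "converge_together x y" "converge_together y z"
  shows "converge_together x z"
  unfolding converge_together_def
proof
  fix R
  obtain N1 where N1: "\<And>i j. i \<ge> N1 \<Longrightarrow> j \<ge> N1 \<Longrightarrow> R + \<delta> \<le> W.gp \<one> (x i) (y j)"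
    using assms(4) unfolding converge_together_def by meson
  obtain N2 where N2: "\<And>i j. i \<ge> N2 \<Longrightarrow> j \<ge> N2 \<Longrightarrow> R + \<delta> \<le> W.gp \<one> (y i) (z j)"
    using assms(5) unfolding converge_together_def by meson
  have "R \<le> W.gp \<one> (x i) (z j)" if "i \<ge> max N1 N2" "j \<ge> max N1 N2" for i j
    using N1[of i "max N1 N2"] N2[of "max N1 N2" j] that
      hyp[OF one_closed x(1)[of i] x(2)[of "max N1 N2"] x(3)[of j]] by simp
  then show "\<exists>N. \<forall>i\<ge>N. \<forall>j\<ge>N. R \<le> W.gp \<one> (x i) (z j)" by blast
qed

lemma converge_together_sym:
  assumes "\<And>i. x i \<in> carrier G" "\<And>i. y i \<in> carrier G" "converge_together x y"
  shows "converge_together y x"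
  using assms(3) unfolding converge_together_def
  by (metis W.gp_sym assms(1,2))

lemma equiv_boundary_rel: "equiv (gromov_seqs G S) (boundary_rel G S)"
proof (rule equivI)
  show "boundary_rel G S \<subseteq> gromov_seqs G S \<times> gromov_seqs G S" by (auto simp: boundary_rel_iff)
  show "refl_on (gromov_seqs G S) (boundary_rel G S)"
    by (auto simp: refl_on_def boundary_rel_iff gromov_seqs_iff)
  show "sym (boundary_rel G S)"
    using converge_together_sym gromov_seq_closed by (intro symI) (simp add: boundary_rel_iff)
  show "trans (boundary_rel G S)"
    proof (rule transI)
    fix x y z assume xy: "(x, y) \<in> boundary_rel G S" and yz: "(y, z) \<in> boundary_rel G S"
    then have "converge_together x z"
      by (intro converge_together_trans[of x y z]) (simp_all add: boundary_rel_iff gromov_seq_closed)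
    then show "(x, z) \<in> boundary_rel G S" using xy yz by (simp add: boundary_rel_iff)
  qed
qed

lemma gromov_seqs_boundary_rel_change_generators:
  assumes T: "finitely_generated_group G T"
  shows "gromov_seqs G T = gromov_seqs G S" "boundary_rel G T = boundary_rel G S"
proof -
  let ?gT = "gromov_product (word_dist G T)"
  have id: "(\<lambda>x. x) \<in> hom G G" "bij_betw (\<lambda>x. x) (carrier G) (carrier G)"
    by (auto simp: hom_def bij_betw_def inj_on_def)
  obtain c C where "c > 0" and *: "\<forall>w\<in>carrier G. \<forall>x\<in>carrier G. \<forall>y\<in>carrier G.
       W.gp w x y \<ge> c * ?gT w x y - C \<and> ?gT w x y \<ge> c * W.gp w x y - C"
    using products_comparable_of_automorphism[OF T id] by blast
  have c: "W.gp \<one> x y \<ge> c * ?gT \<one> x y - C" "?gT \<one> x y \<ge> c * W.gp \<one> x y - C"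
    if "x \<in> carrier G" "y \<in> carrier G" for x y
    using * that by simp_all
  have eq: "(\<forall>R. \<exists>N. \<forall>i\<ge>N. \<forall>j\<ge>N. R \<le> ?gT \<one> (x i) (y j)) \<longleftrightarrow> converge_together x y"
    if xy: "\<And>i. x i \<in> carrier G" "\<And>i. y i \<in> carrier G" for x y
  proof
    assume "\<forall>R. \<exists>N. \<forall>i\<ge>N. \<forall>j\<ge>N. R \<le> ?gT \<one> (x i) (y j)"
    then show "converge_together x y"
      unfolding converge_together_def by (rule tends_to_infinity_comparison[OF _ \<open>c > 0\<close> c(1)[OF xy]])
  next
    assume "converge_together x y"
    then show "\<forall>R. \<exists>N. \<forall>i\<ge>N. \<forall>j\<ge>N. R \<le> ?gT \<one> (x i) (y j)"
      unfolding converge_together_def by (rule tends_to_infinity_comparison[OF _ \<open>c > 0\<close> c(2)[OF xy]])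
  qed
  show seqs: "gromov_seqs G T = gromov_seqs G S"
  proof (rule Set.set_eqI)
    fix x
    show "x \<in> gromov_seqs G T \<longleftrightarrow> x \<in> gromov_seqs G S"
    proof (cases "range x \<subseteq> carrier G")
      case True
      then show ?thesis
        using eq[of x x] unfolding gromov_seqs_iff
        unfolding gromov_seqs_def mem_Collect_eq tends_to_infinity_iff by auto
    next
      case False
      then show ?thesis by (simp add: gromov_seqs_def)
    qed
  qed
  show "boundary_rel G T = boundary_rel G S"
  proof (rule Set.set_eqI)
    fix p :: "(nat \<Rightarrow> 'a) \<times> (nat \<Rightarrow> 'a)"
    obtain x y where p: "p = (x, y)" by (rule prod.exhaust)
    have "(x, y) \<in> boundary_rel G T \<longleftrightarrow> x \<in> gromov_seqs G S \<and> y \<in> gromov_seqs G S \<and>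
        (\<forall>R. \<exists>N. \<forall>i\<ge>N. \<forall>j\<ge>N. R \<le> ?gT \<one> (x i) (y j))"
      unfolding boundary_rel_def mem_Collect_eq split_conv tends_to_infinity_iff seqs ..
    then show "p \<in> boundary_rel G T \<longleftrightarrow> p \<in> boundary_rel G S"
      using eq[of x y] by (auto simp: p boundary_rel_iff gromov_seq_closed)
  qed
qed

lemma converge_together_auto:
  assumes f: "f \<in> auto G" and x: "\<And>i. x i \<in> carrier G" "\<And>i. y i \<in> carrier G" and "converge_together x y"
  shows "converge_together (f \<circ> x) (f \<circ> y)"
proof -
  have fh: "f \<in> hom G G" "bij_betw f (carrier G) (carrier G)" using f by (auto simp: auto_def Bij_def)
  interpret f: group_hom G G f using fh is_group by (simp add: group_hom_def group_hom_axioms_def)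
  obtain c C where "c > 0" and *: "\<forall>w\<in>carrier G. \<forall>x\<in>carrier G. \<forall>y\<in>carrier G.
       W.gp w x y \<ge> c * W.gp (f w) (f x) (f y) - C \<and> W.gp (f w) (f x) (f y) \<ge> c * W.gp w x y - C"
    using products_comparable_of_automorphism[OF finitely_generated_group_axioms fh] by blast
  have "W.gp \<one> (f (x i)) (f (y j)) \<ge> c * W.gp \<one> (x i) (y j) - C" for i j
    using *[rule_format, OF one_closed x(1)[of i] x(2)[of j]] by simp
  from tends_to_infinity_comparison[OF _ \<open>c > 0\<close> this] show ?thesis
    using assms(4) by (simp add: converge_together_def)
qed

lemma auto_closed: "f \<in> auto G \<Longrightarrow> x \<in> carrier G \<Longrightarrow> f x \<in> carrier G"
  by (auto simp: auto_def hom_def)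

lemma gromov_seqs_auto: "f \<in> auto G \<Longrightarrow> x \<in> gromov_seqs G S \<Longrightarrow> f \<circ> x \<in> gromov_seqs G S"
proof -
  assume f: "f \<in> auto G" and x: "x \<in> gromov_seqs G S"
  have "converge_together (f \<circ> x) (f \<circ> x)"
    using x by (intro converge_together_auto[OF f]) (simp_all add: gromov_seqs_iff gromov_seq_closed)
  then show ?thesis using auto_closed[OF f] gromov_seq_closed[OF x] by (auto simp: gromov_seqs_iff)
qed

lemma boundary_rel_auto:
  "f \<in> auto G \<Longrightarrow> (x, y) \<in> boundary_rel G S \<Longrightarrow> (f \<circ> x, f \<circ> y) \<in> boundary_rel G S"
proof -
  assume f: "f \<in> auto G" and xy: "(x, y) \<in> boundary_rel G S"
  then have "converge_together (f \<circ> x) (f \<circ> y)"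
    by (intro converge_together_auto[OF f]) (simp_all add: boundary_rel_iff gromov_seq_closed)
  then show ?thesis using xy gromov_seqs_auto[OF f] by (simp add: boundary_rel_iff)
qed

lemma class_in_boundary: "x \<in> gromov_seqs G S \<Longrightarrow> boundary_rel G S `` {x} \<in> gromov_boundary G S"
  unfolding gromov_boundary_def by (rule quotientI)

lemma boundary_map_class:
  assumes f: "f \<in> auto G" and x: "x \<in> gromov_seqs G S"
  shows "boundary_map G S f (boundary_rel G S `` {x}) = boundary_rel G S `` {f \<circ> x}"
proof -
  have "(\<lambda>x. boundary_rel G S `` {f \<circ> x}) respects boundary_rel G S"
    by (intro congruentI equiv_class_eq[OF equiv_boundary_rel] boundary_rel_auto[OF f])
  then show ?thesis
    unfolding boundary_map_def restrict_apply' [OF class_in_boundary[OF x]]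
    using UN_equiv_class[OF equiv_boundary_rel _ x] by blast
qed

lemma boundary_cases:
  assumes "\<xi> \<in> gromov_boundary G S"
  obtains x where "x \<in> gromov_seqs G S" "\<xi> = boundary_rel G S `` {x}"
  using assms unfolding gromov_boundary_def by (rule quotientE)

lemma boundary_map_closed:
  "f \<in> auto G \<Longrightarrow> \<xi> \<in> gromov_boundary G S \<Longrightarrow> boundary_map G S f \<xi> \<in> gromov_boundary G S"
  by (erule boundary_cases) (simp add: boundary_map_class class_in_boundary gromov_seqs_auto)

lemma boundary_map_compose:
  assumes f: "f \<in> auto G" and g: "g \<in> auto G" and fg: "compose (carrier G) f g \<in> auto G" and \<xi>: "\<xi> \<in> gromov_boundary G S"
  shows "boundary_map G S (compose (carrier G) f g) \<xi> = boundary_map G S f (boundary_map G S g \<xi>)"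
  using \<xi>
proof (rule boundary_cases)
  fix x assume x: "x \<in> gromov_seqs G S" "\<xi> = boundary_rel G S `` {x}"
  have "compose (carrier G) f g \<circ> x = f \<circ> (g \<circ> x)"
    using gromov_seq_closed[OF x(1)] by (auto simp: compose_def)
  then show ?thesis using x f g fg by (simp add: boundary_map_class gromov_seqs_auto)
qed

lemma boundary_map_one:
  assumes "\<xi> \<in> gromov_boundary G S"
  shows "boundary_map G S (\<lambda>x\<in>carrier G. x) \<xi> = \<xi>"
  using assms
proof (rule boundary_cases)
  fix x assume x: "x \<in> gromov_seqs G S" "\<xi> = boundary_rel G S `` {x}"
  have "(\<lambda>x\<in>carrier G. x) \<circ> x = x" using gromov_seq_closed[OF x(1)] by auto
  then show ?thesis using x id_in_auto by (simp add: boundary_map_class)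
qed

lemma AutoGroup_simps:
  "carrier (AutoGroup G) = auto G"
  "f \<in> auto G \<Longrightarrow> g \<in> auto G \<Longrightarrow> f \<otimes>\<^bsub>AutoGroup G\<^esub> g = compose (carrier G) f g"
  "\<one>\<^bsub>AutoGroup G\<^esub> = (\<lambda>x\<in>carrier G. x)"
  by (auto simp: AutoGroup_def BijGroup_def auto_def)

lemma group_action_boundary: "group_action (AutoGroup G) (gromov_boundary G S) (boundary_map G S)"
proof -
  interpret A: group "AutoGroup G" by (rule AutoGroup)
  let ?E = "gromov_boundary G S" and ?\<phi> = "boundary_map G S"
  have comp: "?\<phi> (f \<otimes>\<^bsub>AutoGroup G\<^esub> g) \<xi> = ?\<phi> f (?\<phi> g \<xi>)" if "f \<in> auto G" "g \<in> auto G" "\<xi> \<in> ?E" for f g \<xi>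
    using boundary_map_compose[of f g \<xi>] A.m_closed[of f g] that by (simp add: AutoGroup_simps)
  have bij: "?\<phi> f \<in> Bij ?E" if f: "f \<in> auto G" for f
  proof -
    define f' where "f' = inv\<^bsub>AutoGroup G\<^esub> f"
    have f': "f' \<in> auto G" using A.inv_closed f by (simp add: f'_def AutoGroup_simps)
    have "?\<phi> f (?\<phi> f' \<xi>) = \<xi>" "?\<phi> f' (?\<phi> f \<xi>) = \<xi>" if \<xi>: "\<xi> \<in> ?E" for \<xi>
      using comp[OF f f' \<xi>] comp[OF f' f \<xi>] A.r_inv[of f] A.l_inv[of f] f boundary_map_one[OF \<xi>]
      by (simp_all add: f'_def AutoGroup_simps)
    then have "bij_betw (?\<phi> f) ?E ?E"
      using boundary_map_closed[OF f] boundary_map_closed[OF f']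
      by (intro bij_betw_byWitness[where f' = "?\<phi> f'"]) auto
    then show ?thesis by (simp add: Bij_def boundary_map_def)
  qed
  have "?\<phi> \<in> hom (AutoGroup G) (BijGroup ?E)"
  proof (rule homI)
    show "?\<phi> f \<in> carrier (BijGroup ?E)" if "f \<in> carrier (AutoGroup G)" for f
      using that bij by (simp add: AutoGroup_simps BijGroup_def)
    show "?\<phi> (f \<otimes>\<^bsub>AutoGroup G\<^esub> g) = ?\<phi> f \<otimes>\<^bsub>BijGroup ?E\<^esub> ?\<phi> g"
      if "f \<in> carrier (AutoGroup G)" "g \<in> carrier (AutoGroup G)" for f g
    proof -
      have fg: "f \<in> auto G" "g \<in> auto G" "f \<otimes>\<^bsub>AutoGroup G\<^esub> g \<in> auto G"
        using that A.m_closed[OF that] by (simp_all add: AutoGroup_simps)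
      have "?\<phi> (f \<otimes>\<^bsub>AutoGroup G\<^esub> g) = compose ?E (?\<phi> f) (?\<phi> g)"
      proof (rule extensionalityI)
        show "?\<phi> (f \<otimes>\<^bsub>AutoGroup G\<^esub> g) \<in> extensional ?E" using bij[OF fg(3)] by (simp add: Bij_def)
        show "compose ?E (?\<phi> f) (?\<phi> g) \<in> extensional ?E" by simp
        show "?\<phi> (f \<otimes>\<^bsub>AutoGroup G\<^esub> g) \<xi> = compose ?E (?\<phi> f) (?\<phi> g) \<xi>" if "\<xi> \<in> ?E" for \<xi>
          using comp[OF fg(1,2) that] that by (simp add: compose_def)
      qed
      then show ?thesis using bij[OF fg(1)] bij[OF fg(2)] by (simp add: BijGroup_def)
    qed
  qed
  then show ?thesis
    unfolding group_action_def group_hom_def group_hom_axioms_def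
    using A.is_group group_BijGroup by blast
qed

text \<open>Faithfulness of an action only has to be tested on its kernel, and membership in the kernel can be
  read off from sequences: the class of \<open>x\<close> is fixed exactly if \<open>x\<close> and \<open>f \<circ> x\<close> converge together.\<close>

lemma faithful_action_boundaryI:
  assumes "\<And>f. f \<in> auto G \<Longrightarrow> (\<And>x. x \<in> gromov_seqs G S \<Longrightarrow> converge_together x (f \<circ> x)) \<Longrightarrow>
      (\<And>g. g \<in> carrier G \<Longrightarrow> f g = g)"
  shows "faithful_action (AutoGroup G) (gromov_boundary G S) (boundary_map G S)"
proof -
  interpret act: group_action "AutoGroup G" "gromov_boundary G S" "boundary_map G S"
    by (rule group_action_boundary)
  interpret h: group_hom "AutoGroup G" "BijGroup (gromov_boundary G S)" "boundary_map G S"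
    by (rule act.group_hom)
  have "f = \<one>\<^bsub>AutoGroup G\<^esub>"
    if f: "f \<in> auto G" and triv: "boundary_map G S f = \<one>\<^bsub>BijGroup (gromov_boundary G S)\<^esub>" for f
  proof -
    have "converge_together x (f \<circ> x)" if x: "x \<in> gromov_seqs G S" for x
    proof -
      have "boundary_rel G S `` {f \<circ> x} = boundary_rel G S `` {x}"
        using boundary_map_class[OF f x] class_in_boundary[OF x] by (simp add: triv BijGroup_def)
      then show ?thesis
        using eq_equiv_class[OF _ equiv_boundary_rel, of "x" "f \<circ> x"] gromov_seqs_auto[OF f x] by (auto simp: boundary_rel_iff)
    qed
    then have "f g = g" if "g \<in> carrier G" for g using assms f that by blast
    moreover have "f \<in> extensional (carrier G)" using f by (simp add: auto_def Bij_def)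
    ultimately show ?thesis by (auto simp: AutoGroup_simps intro: extensionalityI)
  qed
  then have "kernel (AutoGroup G) (BijGroup (gromov_boundary G S)) (boundary_map G S) = {\<one>\<^bsub>AutoGroup G\<^esub>}"
    using h.hom_one h.G.one_closed unfolding kernel_def AutoGroup_simps(1) by blast
  then have "inj_on (boundary_map G S) (carrier (AutoGroup G))" using h.inj_iff_trivial_ker by simp
  then show ?thesis by (intro faithful_action.intro act.group_action_axioms faithful_action_axioms.intro)
qed

end

section \<open>Groups with unique roots\<close>

lemma (in group) central_int_pow:
  assumes k: "k \<in> carrier G" and central: "\<And>g. g \<in> carrier G \<Longrightarrow> k \<otimes> g = g \<otimes> k"
    and g: "g \<in> carrier G"
  shows "k [^] (n::int) \<otimes> g = g \<otimes> k [^] n"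
proof -
  have nat: "k [^] i \<otimes> g = g \<otimes> k [^] i" for i :: nat
  proof (induction i)
    case 0 then show ?case using g by simp
  next
    case (Suc i)
    have "k [^] Suc i \<otimes> g = k [^] i \<otimes> (g \<otimes> k)" using central[OF g] k g by (simp add: m_assoc)
    also have "\<dots> = g \<otimes> k [^] Suc i" using Suc k g by (simp add: m_assoc[symmetric])
    finally show ?case .
  qed
  obtain i where "n = int i \<or> n = - int i" by (meson int_cases2)
  moreover have "inv (k [^] i) \<otimes> g = g \<otimes> inv (k [^] i)"
    using nat[of i] k g by (metis nat_pow_closed inv_closed inv_solve_left inv_solve_right m_assoc m_closed)
  ultimately show ?thesis using nat k by (auto simp: int_pow_int int_pow_neg)
qed

text \<open>If \<open>x < y\<close> then \<open>x\<^sup>n < y\<^sup>n\<close>, by multiplying inequalities; this uses invariance on both sides.\<close>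

lemma (in group) bi_orderable_unique_roots:
  assumes "bi_orderable G" and x: "x \<in> carrier G" and y: "y \<in> carrier G"
    and "0 < n" and eq: "x [^] n = y [^] (n::nat)"
  shows "x = y"
proof -
  obtain r where tr: "trans r" and ir: "irrefl r" and tot: "total_on (carrier G) r"
    and mono: "\<And>f g h. f \<in> carrier G \<Longrightarrow> g \<in> carrier G \<Longrightarrow> h \<in> carrier G \<Longrightarrow> (g, h) \<in> r \<Longrightarrow>
       (f \<otimes> g, f \<otimes> h) \<in> r \<and> (g \<otimes> f, h \<otimes> f) \<in> r"
    using assms(1) unfolding bi_orderable_def strict_linear_order_on_def by blast
  have pow: "(a [^] Suc m, b [^] Suc m) \<in> r" if a: "a \<in> carrier G" and b: "b \<in> carrier G" and ab: "(a, b) \<in> r" for a b m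
  proof (induction m)
    case 0
    then show ?case using ab a b by simp
  next
    case (Suc m)
    have "(a [^] Suc m \<otimes> a, b [^] Suc m \<otimes> a) \<in> r"
      using mono[of a "a [^] Suc m" "b [^] Suc m"] Suc a b nat_pow_closed by blast
    moreover have "(b [^] Suc m \<otimes> a, b [^] Suc m \<otimes> b) \<in> r"
      using mono[of "b [^] Suc m" a b] a b ab nat_pow_closed by blast
    ultimately show ?case using tr by (metis nat_pow_Suc transD)
  qed
  obtain m where m: "n = Suc m" using \<open>0 < n\<close> by (cases n) auto
  have "(x, y) \<notin> r" using pow[OF x y, of m] ir eq by (auto simp: m irrefl_def)
  moreover have "(y, x) \<notin> r" using pow[OF y x, of m] ir eq by (auto simp: m irrefl_def)
  ultimately show ?thesis using tot x y by (auto simp: total_on_def)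
qed

locale unique_roots_group = group G for G (structure) +
  assumes unique_root: "x \<in> carrier G \<Longrightarrow> y \<in> carrier G \<Longrightarrow> 0 < (n::nat) \<Longrightarrow> x [^] n = y [^] n \<Longrightarrow> x = y"
begin

lemma torsion_free: "x \<in> carrier G \<Longrightarrow> 0 < (n::nat) \<Longrightarrow> x [^] n = \<one> \<Longrightarrow> x = \<one>"
  using unique_root[of x \<one> n] by simp

lemma torsion_free_int: 
  assumes x: "x \<in> carrier G" "x \<noteq> \<one>" and "x [^] (n::int) = \<one>" 
  shows "n = 0"
proof -
  obtain m where m: "n = int m \<or> n = - int m" by (meson int_cases2)
  then have "x [^] m = \<one>"
    using assms by (auto simp: int_pow_neg int_pow_int inv_eq_1_iff)
  then show ?thesis using torsion_free[of x m] x m by (cases "m = 0") auto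
qed

lemma int_pow_inj: "x \<in> carrier G \<Longrightarrow> x \<noteq> \<one> \<Longrightarrow> x [^] (m::int) = x [^] (n::int) \<Longrightarrow> m = n"
  using torsion_free_int[of x "m - n"] by (simp add: int_pow_diff)

text \<open>The elements \<open>h\<close> and \<open>k\<inverse> h k\<close> have the same \<open>m\<close>-th power.\<close>

lemma commute_if_power_commutes:
  assumes h: "h \<in> carrier G" and k: "k \<in> carrier G" and "0 < m" and c: "k \<otimes> h [^] (m::nat) = h [^] m \<otimes> k"
  shows "k \<otimes> h = h \<otimes> k"
proof -
  have conj: "(inv k \<otimes> h \<otimes> k) [^] n = inv k \<otimes> h [^] n \<otimes> k" for n :: nat
  proof (induction n)
    case 0 then show ?case using k by simp
  next
    case (Suc n) then show ?case using h k by (simp add: m_assoc cancel_inv_right)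
  qed
  have "(inv k \<otimes> h \<otimes> k) [^] m = h [^] m"
    unfolding conj using h k c[symmetric] by (simp add: m_assoc cancel_inv_left)
  then have "inv k \<otimes> h \<otimes> k = h" using unique_root[of "inv k \<otimes> h \<otimes> k" h m] h k \<open>0 < m\<close> by simp
  then have "k \<otimes> h = k \<otimes> (inv k \<otimes> (h \<otimes> k))" using h k by (simp add: m_assoc)
  then show ?thesis using h k by (simp add: cancel_inv_right)
qed

text \<open>The map \<open>h \<mapsto> \<phi> h\<close> with \<open>h\<^sup>M = k\<^bsup>\<phi> h\<^esup>\<close> is an embedding into the integers. An element with the
  least positive value generates, by division with remainder.\<close>

lemma cyclic_if_bounded_multiple_in_cyclic_subgroup:
  assumes comm: "\<And>x y. x \<in> carrier G \<Longrightarrow> y \<in> carrier G \<Longrightarrow> x \<otimes> y = y \<otimes> x"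
    and k: "k \<in> carrier G" "k \<noteq> \<one>" and "0 < M"
    and M: "\<And>h. h \<in> carrier G \<Longrightarrow> \<exists>n::int. h [^] int M = k [^] n"
  shows "\<exists>e\<in>carrier G. \<forall>h\<in>carrier G. \<exists>n::int. h = e [^] n"
proof -
  interpret comm_group G using comm by (intro group_comm_groupI) 
  obtain \<phi> where \<phi>: "\<And>h. h \<in> carrier G \<Longrightarrow> h [^] int M = k [^] (\<phi> h :: int)" using M by metis
  have \<phi>_eqI: "\<phi> h = n" if "h \<in> carrier G" "h [^] int M = k [^] n" for h n
    using int_pow_inj[OF k, of "\<phi> h" n] \<phi> that by simp
  have "\<phi> k = int M" using \<phi>_eqI k by blast
  define P where "P = (\<lambda>n. 0 < n \<and> (\<exists>h\<in>carrier G. \<phi> h = int n))"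
  have "P M" using \<open>0 < M\<close> \<open>\<phi> k = int M\<close> k by (auto simp: P_def)
  define a where "a = (LEAST n. P n)"
  have "P a" unfolding a_def using \<open>P M\<close> by (rule LeastI)
  then obtain e where e: "e \<in> carrier G" "\<phi> e = int a" "0 < a" by (auto simp: P_def)
  have "h = e [^] (\<phi> h div int a)" if h: "h \<in> carrier G" for h
  proof -
    define q where "q = \<phi> h div int a"
    define g where "g = h \<otimes> e [^] (- q)"
    have g: "g \<in> carrier G" using h e by (simp add: g_def)
    have "g [^] int M = h [^] int M \<otimes> (e [^] int M) [^] (- q)"
      unfolding g_def using h e by (simp add: int_pow_distrib int_pow_pow mult.commute)
    also have "\<dots> = k [^] (\<phi> h - int a * q)"
      using \<phi>[OF h] \<phi>[OF e(1)] e k by (simp add: int_pow_pow int_pow_mult flip: diff_conv_add_uminus)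
        (simp add: int_pow_mult[symmetric] k)
    finally have "\<phi> g = \<phi> h - int a * q" using \<phi>_eqI g by blast
    also have "\<dots> = \<phi> h mod int a" by (simp add: q_def minus_mult_div_eq_mod)
    finally have \<phi>g: "\<phi> g = \<phi> h mod int a" .
    have "\<phi> g = 0"
    proof (rule ccontr)
      assume "\<phi> g \<noteq> 0"
      moreover have "0 \<le> \<phi> g" "\<phi> g < int a" unfolding \<phi>g using e by auto
      ultimately have "P (nat (\<phi> g))" "nat (\<phi> g) < a" using g by (auto simp: P_def intro!: bexI[of _ g])
      then show False using not_less_Least[of "nat (\<phi> g)" P] by (simp add: a_def)
    qed
    then have "g [^] M = \<one>" using \<phi>[OF g] by (simp add: int_pow_int)
    then have "g = \<one>" using torsion_free g \<open>0 < M\<close> by blast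
    then have "h \<otimes> inv (e [^] q) = \<one>" using e by (simp add: g_def int_pow_neg)
    then show ?thesis unfolding q_def[symmetric] using h e by (simp add: inv_solve_right')
  qed
  then show ?thesis using e by blast
qed

end

section \<open>Boundary points and elements fixing all of them\<close>

context hyperbolic_word_metric
begin

lemma four_point:
  assumes "x \<in> carrier G" "y \<in> carrier G" "z \<in> carrier G" "w \<in> carrier G"
  shows "dS x z + dS y w \<le> max (dS x y + dS z w) (dS y z + dS x w) + 2 * \<delta>"
  using hyp[of w x y z] assms by (simp add: gromov_product_def min_def max_def field_simps split: if_splits)

lemma gromov_seqs_subseq:
  assumes x: "x \<in> gromov_seqs G S" and r: "strict_mono r"
  shows "x \<circ> r \<in> gromov_seqs G S"
proof -
  have "converge_together (x \<circ> r) (x \<circ> r)"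
    unfolding converge_together_def
  proof
    fix R
    obtain N where N: "\<And>i j. i \<ge> N \<Longrightarrow> j \<ge> N \<Longrightarrow> R \<le> W.gp \<one> (x i) (x j)"
      using x unfolding gromov_seqs_iff converge_together_def by meson
    have "i \<ge> N \<Longrightarrow> r i \<ge> N" for i using seq_suble[OF r, of i] by simp
    then show "\<exists>N. \<forall>i\<ge>N. \<forall>j\<ge>N. R \<le> W.gp \<one> ((x \<circ> r) i) ((x \<circ> r) j)" using N by (intro exI[of _ N]) auto
  qed
  then show ?thesis using gromov_seq_closed[OF x] by (auto simp: gromov_seqs_iff)
qed

text \<open>Sequential compactness of the group together with its boundary. For every radius \<open>n\<close> there are only
  finitely many possibilities for the point \<open>pr n g\<close> at distance \<open>n\<close> from \<open>\<one>\<close> on a chosen geodesic to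
  \<open>g\<close>. A diagonal subsequence makes all these points eventually constant, and two elements whose geodesics
  pass through a common point at distance \<open>n\<close> have Gromov product at least \<open>n\<close>.\<close>

lemma gromov_subsequence_exists:
  assumes x: "\<And>i. x i \<in> carrier G" and len: "\<And>i. i \<le> len (x i)"
  shows "\<exists>r. strict_mono r \<and> x \<circ> r \<in> gromov_seqs G S"
proof -
  have "\<exists>p. geodesic_path (carrier G) dS p (len g) \<one> g" if "g \<in> carrier G" for g
  proof -
    obtain p n where p: "geodesic_path (carrier G) dS p n \<one> g" using W.geodesic[OF one_closed \<open>g \<in> carrier G\<close>] by blast
    then have "dS \<one> g = real n" by (auto simp: geodesic_path_def)
    then have "n = len g" using dist_one that by simp
    then show ?thesis using p by blast
  qed
  then obtain p where p: "\<And>g. g \<in> carrier G \<Longrightarrow> geodesic_path (carrier G) dS (p g) (len g) \<one> g" by metis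
  define pr where "pr n g = p g (min n (len g))" for n g
  have pr: "pr n g \<in> carrier G" "len (pr n g) = min n (len g)" "dS (pr n g) g = real (len g) - real (min n (len g))"
    if g: "g \<in> carrier G" for n g
  proof -
    have ends: "p g 0 = \<one>" "p g (len g) = g" and pM: "\<And>i. i \<le> len g \<Longrightarrow> p g i \<in> carrier G"
      and pd: "\<And>i j. i \<le> len g \<Longrightarrow> j \<le> len g \<Longrightarrow> dS (p g i) (p g j) = \<bar>real i - real j\<bar>"
      using p[OF g] unfolding geodesic_path_def by blast+
    show mem: "pr n g \<in> carrier G" unfolding pr_def by (intro pM) simp
    show "len (pr n g) = min n (len g)"
      using pd[of 0 "min n (len g)"] dist_one[OF mem] unfolding pr_def[symmetric] ends by simp
    show "dS (pr n g) g = real (len g) - real (min n (len g))"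
      using pd[of "min n (len g)" "len g"] unfolding pr_def[symmetric] ends by simp
  qed
  interpret subseqs "\<lambda>n s. \<exists>c. \<forall>i. pr n (x (s i)) = c"
  proof
    fix n and s :: "nat \<Rightarrow> nat"
    have "(\<lambda>i. pr n (x (s i))) ` UNIV \<subseteq> {g \<in> carrier G. len g \<le> n}" using pr x by auto
    then have "finite (range (\<lambda>i. pr n (x (s i))))" using finite_ball finite_subset by blast
    then obtain i0 where "infinite {i \<in> UNIV. pr n (x (s i)) = pr n (x (s i0))}"
      using pigeonhole_infinite[of "UNIV :: nat set" "\<lambda>i. pr n (x (s i))"] by auto
    then obtain r :: "nat \<Rightarrow> nat" where "strict_mono r" "\<forall>i. r i \<in> {i \<in> UNIV. pr n (x (s i)) = pr n (x (s i0))}"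
      using infinite_enumerate by blast
    then show "\<exists>r' :: nat \<Rightarrow> nat. strict_mono r' \<and> (\<exists>c. \<forall>i. pr n (x ((s \<circ> r') i)) = c)" by (intro exI[of _ r]) auto
  qed
  have const: "\<exists>c. \<forall>i. pr k (x (diagseq (Suc k + i))) = c" for k
    using diagseq_holds[of k] by (auto simp: o_def)
  have sub: "i \<le> diagseq i" for i using seq_suble[OF subseq_diagseq] .
  have "converge_together (x \<circ> diagseq) (x \<circ> diagseq)"
    unfolding converge_together_def
  proof
    fix R :: real
    define k where "k = nat \<lceil>R\<rceil>"
    obtain c where c: "\<And>i. pr k (x (diagseq (Suc k + i))) = c" using const[of k] by blast
    have c': "pr k (x (diagseq i)) = c \<and> k \<le> len (x (diagseq i))" if "Suc k \<le> i" for i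
      using c[of "i - Suc k"] that len[of "diagseq i"] sub[of i] by simp
    have "R \<le> W.gp \<one> (x (diagseq i)) (x (diagseq j))" if ij: "Suc k \<le> i" "Suc k \<le> j" for i j
    proof -
      define a b where "a = x (diagseq i)" and "b = x (diagseq j)"
      have ab: "a \<in> carrier G" "b \<in> carrier G" "c \<in> carrier G" "dS c a = real (len a) - real k" "dS c b = real (len b) - real k"
        using c'[OF ij(1)] c'[OF ij(2)] pr[of "x (diagseq i)" k] pr[of "x (diagseq j)" k] x
        unfolding a_def b_def by auto
      have "dS a b \<le> real (len a) + real (len b) - 2 * real k"
        using W.triangle[of a c b] W.sym[of a c] ab by simp
      then have "real k \<le> W.gp \<one> a b" using ab by (simp add: gromov_product_def dist_one_right)
      moreover have "R \<le> real k" unfolding k_def by linarith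
      ultimately show ?thesis by (simp add: a_def b_def)
    qed
    then show "\<exists>N. \<forall>i\<ge>N. \<forall>j\<ge>N. R \<le> W.gp \<one> ((x \<circ> diagseq) i) ((x \<circ> diagseq) j)"
      by (intro exI[of _ "Suc k"]) auto
  qed
  then show ?thesis using subseq_diagseq x by (intro exI[of _ diagseq]) (auto simp: gromov_seqs_iff)
qed

text \<open>Translating the midpoints of longer and longer geodesics to \<open>\<one>\<close>, the two end points converge, along a
  subsequence, to the ends of a bi-infinite geodesic through \<open>\<one>\<close>.\<close>

lemma opposite_gromov_seqs_exist:
  assumes "\<And>n. \<exists>g\<in>carrier G. n \<le> len g"
  shows "\<exists>x\<in>gromov_seqs G S. \<exists>y\<in>gromov_seqs G S. \<forall>i. W.gp \<one> (x i) (y i) = 0"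
proof -
  have "\<exists>a b. a \<in> carrier G \<and> b \<in> carrier G \<and> n \<le> len a \<and> n \<le> len b \<and> W.gp \<one> a b = 0" for n
  proof -
    obtain g where g: "g \<in> carrier G" "2 * n \<le> len g" using assms by blast
    obtain p N where p: "geodesic_path (carrier G) dS p N \<one> g" using W.geodesic[OF one_closed g(1)] by blast
    define m where "m = N div 2"
    have N: "dS \<one> g = real N" using p by (auto simp: geodesic_path_def)
    have Ng: "N = len g" using N dist_one[OF g(1)] by simp
    have m: "m \<le> N" "n \<le> m" "n \<le> N - m" using g unfolding Ng m_def by auto
    have pm: "p m \<in> carrier G" "dS (p 0) (p m) = real m" "dS (p m) (p N) = real N - real m" "p 0 = \<one>" "p N = g"
      using p m by (auto simp: geodesic_path_def)
    define a b where "a = inv (p m)" and "b = inv (p m) \<otimes> g"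
    have ab: "a \<in> carrier G" "b \<in> carrier G" using pm g by (auto simp: a_def b_def)
    have la: "real (len a) = real m" using pm dist_one[OF pm(1)] by (simp add: a_def len_inv)
    have lb: "real (len b) = real N - real m" using pm by (simp add: b_def word_dist_def)
    have "dS a b = dS (inv (p m) \<otimes> \<one>) (inv (p m) \<otimes> g)" using pm by (simp add: a_def b_def)
    also have "\<dots> = real N" using pm g N by (subst dist_mult_left) auto
    finally have "W.gp \<one> a b = 0" using ab la lb by (simp add: gromov_product_def dist_one_right)
    moreover have "n \<le> len a" "n \<le> len b" using la lb m by linarith+
    ultimately show ?thesis using ab by blast
  qed
  then obtain a b where a: "\<And>n. a n \<in> carrier G" "\<And>n. n \<le> len (a n)" and b: "\<And>n. b n \<in> carrier G" "\<And>n. n \<le> len (b n)"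
    and gp: "\<And>n. W.gp \<one> (a n) (b n) = 0" by metis
  obtain r where r: "strict_mono r" "a \<circ> r \<in> gromov_seqs G S" using gromov_subsequence_exists[OF a] by blast
  have "i \<le> len (b (r i))" for i using b(2)[of "r i"] seq_suble[OF r(1), of i] by linarith
  then obtain s where s: "strict_mono s" "(\<lambda>i. b (r i)) \<circ> s \<in> gromov_seqs G S"
    using gromov_subsequence_exists[of "\<lambda>i. b (r i)"] b by blast
  have "(a \<circ> r) \<circ> s \<in> gromov_seqs G S" using gromov_seqs_subseq r s by blast
  then show ?thesis using s gp by (intro bexI[of _ "(a \<circ> r) \<circ> s"] bexI[of _ "(\<lambda>i. b (r i)) \<circ> s"]) auto
qed

lemma converge_together_mult_left:
  assumes g: "g \<in> carrier G" and x: "\<And>i. x i \<in> carrier G" "\<And>i. y i \<in> carrier G" and "converge_together x y"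
  shows "converge_together (\<lambda>i. g \<otimes> x i) (\<lambda>i. g \<otimes> y i)"
proof -
  have "W.gp \<one> (g \<otimes> x i) (g \<otimes> y j) \<ge> 1 * W.gp \<one> (x i) (y j) - real (len g)" for i j
  proof -
    have "W.gp \<one> (x i) (y j) = W.gp (g \<otimes> \<one>) (g \<otimes> x i) (g \<otimes> y j)" using g x by (subst gp_mult_left) auto
    also have "\<dots> \<le> W.gp \<one> (g \<otimes> x i) (g \<otimes> y j) + dS (g \<otimes> \<one>) \<one>" using g x by (intro W.gp_base) auto
    finally show ?thesis using g by (simp add: dist_one_right)
  qed
  from tends_to_infinity_comparison[OF _ zero_less_one this] show ?thesis
    using assms(4) by (simp add: converge_together_def)
qed

lemma gromov_seqs_mult_left: "g \<in> carrier G \<Longrightarrow> x \<in> gromov_seqs G S \<Longrightarrow> (\<lambda>i. g \<otimes> x i) \<in> gromov_seqs G S"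
proof -
  assume g: "g \<in> carrier G" and x: "x \<in> gromov_seqs G S"
  have "converge_together (\<lambda>i. g \<otimes> x i) (\<lambda>i. g \<otimes> x i)"
    using x by (intro converge_together_mult_left[OF g]) (simp_all add: gromov_seqs_iff gromov_seq_closed)
  then show ?thesis using g gromov_seq_closed[OF x] by (auto simp: gromov_seqs_iff)
qed

definition fixes_boundary :: "'a \<Rightarrow> bool"
  where "fixes_boundary k \<longleftrightarrow> (\<forall>x\<in>gromov_seqs G S. converge_together x (\<lambda>i. k \<otimes> x i))"

text \<open>If \<open>a\<close> and \<open>b\<close> are close together as seen from \<open>p\<close>, compared with the distance from \<open>p\<close> to \<open>q\<close>, then
  the Busemann differences \<open>d p a - d q a\<close> and \<open>d p b - d q b\<close> agree up to \<open>2 \<delta>\<close>: of the three sums in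
  the four-point inequality for \<open>p\<close>, \<open>q\<close>, \<open>a\<close>, \<open>b\<close>, the one containing \<open>d a b\<close> is too small to matter.\<close>

lemma busemann_nearly_equal:
  assumes "p \<in> carrier G" "q \<in> carrier G" "a \<in> carrier G" "b \<in> carrier G"
    and far: "dS p q + \<delta> < W.gp p a b"
  shows "dS p a + dS q b \<le> dS p b + dS q a + 2 * \<delta>"
proof -
  have "dS p b \<le> dS p q + dS q b" using W.triangle assms by blast
  then have "dS p q + dS a b + 2 * \<delta> < dS p a + dS q b"
    using far W.sym[of a p] W.sym[of b p] assms by (simp add: gromov_product_def)
  moreover have "dS p a + dS q b \<le> max (dS p q + dS a b) (dS q a + dS p b) + 2 * \<delta>"
    using four_point[of p q a b] assms by simp
  ultimately show ?thesis by (simp add: max_def split: if_splits)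
qed

text \<open>An element \<open>k\<close> fixing a boundary point changes the Busemann function of that point by almost the same
  amount everywhere, so its value at \<open>\<one>\<close>, at most the length of \<open>k\<close>, bounds the change at every \<open>g\<close>. In
  the proof the difference between \<open>k\<close> and \<open>k g\<close> is computed towards \<open>a = x i\<close> and, with error \<open>2 \<delta>\<close>, towards
  \<open>k a\<close>, where it equals the difference between \<open>\<one>\<close> and \<open>g\<close> towards \<open>a\<close>.\<close>

lemma eventually_displacement_towards_fixed_point:
  assumes k: "k \<in> carrier G" and g: "g \<in> carrier G" and x: "\<And>i. x i \<in> carrier G"
    and "converge_together x (\<lambda>i. k \<otimes> x i)"
  shows "\<exists>N. \<forall>i\<ge>N. dS (k \<otimes> g) (x i) \<le> dS g (x i) + real (len k) + 2 * \<delta>"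
proof -
  define D where "D = dS k (k \<otimes> g) + \<delta> + real (len k)"
  obtain N where N: "\<And>i j. i \<ge> N \<Longrightarrow> j \<ge> N \<Longrightarrow> D + 1 \<le> W.gp \<one> (x i) (k \<otimes> x j)"
    using assms(4) unfolding converge_together_def by meson
  have "dS (k \<otimes> g) (x i) \<le> dS g (x i) + real (len k) + 2 * \<delta>" if i: "i \<ge> N" for i
  proof -
    define a where "a = x i"
    have a: "a \<in> carrier G" "k \<otimes> a \<in> carrier G" "k \<otimes> g \<in> carrier G" using x k g by (auto simp: a_def)
    have "D + 1 \<le> W.gp \<one> a (k \<otimes> a)" using N[OF i i] by (simp add: a_def)
    also have "\<dots> \<le> W.gp k a (k \<otimes> a) + real (len k)" using W.gp_base[of \<one> k a "k \<otimes> a"] a k by (simp add: dist_one)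
    also have "W.gp k a (k \<otimes> a) = W.gp k (k \<otimes> a) a" using W.gp_sym a by blast
    finally have "dS k (k \<otimes> a) + dS (k \<otimes> g) a \<le> dS k a + dS (k \<otimes> g) (k \<otimes> a) + 2 * \<delta>"
      using a k by (intro busemann_nearly_equal) (auto simp: D_def)
    moreover have "dS k (k \<otimes> a) = dS \<one> a" using dist_mult_left[of k \<one> a] k a by simp
    moreover have "dS (k \<otimes> g) (k \<otimes> a) = dS g a" using dist_mult_left k a g by blast
    moreover have "dS k a \<le> real (len k) + dS \<one> a" using W.triangle[of k \<one> a] k a by (simp add: dist_one_right)
    ultimately show ?thesis by (simp add: a_def)
  qed
  then show ?thesis by blast
qed

text \<open>The conjugate \<open>g\<inverse> k g\<close> measures how far \<open>k\<close> moves \<open>g\<close>. The point \<open>g\<close> lies on a bi-infinite geodesic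
  whose ends, limits of \<open>g x\<close> and \<open>g y\<close>, are fixed by \<open>k\<close>. Hence \<open>k g\<close> lies near the same geodesic, shifted
  along it by a bounded Busemann difference.\<close>

lemma fixes_boundary_conjugates_bounded:
  assumes k: "k \<in> carrier G" and fix_k: "fixes_boundary k"
    and xy: "x \<in> gromov_seqs G S" "y \<in> gromov_seqs G S" and opp: "\<And>i. W.gp \<one> (x i) (y i) = 0"
    and g: "g \<in> carrier G"
  shows "real (len (inv g \<otimes> k \<otimes> g)) \<le> real (len k) + 4 * \<delta>"
proof -
  have x: "\<And>i. x i \<in> carrier G" and y: "\<And>i. y i \<in> carrier G" using xy gromov_seq_closed by auto
  have "converge_together (\<lambda>i. g \<otimes> z i) (\<lambda>i. k \<otimes> (g \<otimes> z i))" if "z \<in> gromov_seqs G S" for z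
    using fix_k gromov_seqs_mult_left[OF g that] by (simp add: fixes_boundary_def)
  then obtain N1 N2 where 
    N1: "\<And>i. i \<ge> N1 \<Longrightarrow> dS (k \<otimes> g) (g \<otimes> x i) \<le> dS g (g \<otimes> x i) + real (len k) + 2 * \<delta>" and
    N2: "\<And>i. i \<ge> N2 \<Longrightarrow> dS (k \<otimes> g) (g \<otimes> y i) \<le> dS g (g \<otimes> y i) + real (len k) + 2 * \<delta>"
    using eventually_displacement_towards_fixed_point[OF k g, of "\<lambda>i. g \<otimes> x i"]
      eventually_displacement_towards_fixed_point[OF k g, of "\<lambda>i. g \<otimes> y i"] x y xy g by (metis m_closed)
  define i where "i = max N1 N2"
  define a b where "a = g \<otimes> x i" and "b = g \<otimes> y i"
  have ab: "a \<in> carrier G" "b \<in> carrier G" "k \<otimes> g \<in> carrier G" using x y g k by (auto simp: a_def b_def)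
  have A: "dS (k \<otimes> g) a \<le> dS g a + real (len k) + 2 * \<delta>" "dS (k \<otimes> g) b \<le> dS g b + real (len k) + 2 * \<delta>"
    using N1[of i] N2[of i] by (auto simp: a_def b_def i_def)
  have "W.gp (g \<otimes> \<one>) a b = 0" unfolding a_def b_def using gp_mult_left[OF g one_closed x y] opp by simp
  then have ab0: "dS a b = dS g a + dS g b"
    using W.sym[of a g] W.sym[of b g] g ab by (simp add: gromov_product_def)
  have "dS g (k \<otimes> g) + dS a b \<le> max (dS g a + dS (k \<otimes> g) b) (dS a (k \<otimes> g) + dS g b) + 2 * \<delta>"
    using four_point[of g a "k \<otimes> g" b] ab g by simp
  then have "dS g (k \<otimes> g) \<le> real (len k) + 4 * \<delta>"
    using A ab0 W.sym[of a "k \<otimes> g"] ab by (simp add: max_def split: if_splits)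
  moreover have "dS g (k \<otimes> g) = real (len (inv g \<otimes> k \<otimes> g))" using g k by (simp add: word_dist_def m_assoc)
  ultimately show ?thesis by simp
qed

text \<open>A central element moves every point by the same distance \<open>n\<close>, as if every point were on its axis. If
  \<open>u\<^sup>2\<close> were much shorter than \<open>2 n\<close>, geodesics from \<open>u\<close> to \<open>\<one>\<close> and to \<open>u\<^sup>2\<close> would run together for a time
  \<open>t\<close>. With \<open>q\<close> and \<open>r\<close> the points at time \<open>t\<close> on them, \<open>q\<close> and \<open>r\<close> are close, while \<open>r\<close> and
  \<open>u q\<close> lie on the same geodesic from \<open>u\<close> to \<open>u\<^sup>2\<close> at distance \<open>n - 2 t\<close>. Then \<open>u\<close> would move \<open>q\<close> by less
  than \<open>n\<close>.\<close>

lemma central_square_length: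
  assumes u: "u \<in> carrier G" and central: "\<And>g. g \<in> carrier G \<Longrightarrow> u \<otimes> g = g \<otimes> u"
  shows "2 * real (len u) \<le> real (len (u \<otimes> u)) + 8 * \<delta> + 4"
proof -
  define n where "n = len u"
  obtain p n' where p': "geodesic_path (carrier G) dS p n' \<one> u" using W.geodesic[OF one_closed u] by blast
  have "dS \<one> u = real n'" using p' by (auto simp: geodesic_path_def)
  then have "n' = n" using dist_one[OF u] by (simp add: n_def)
  then have p: "geodesic_path (carrier G) dS p n \<one> u" using p' by simp
  have pM: "\<And>i. i \<le> n \<Longrightarrow> p i \<in> carrier G" and pd: "\<And>i j. i \<le> n \<Longrightarrow> j \<le> n \<Longrightarrow> dS (p i) (p j) = \<bar>real i - real j\<bar>"
    and pe: "p 0 = \<one>" "p n = u"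
    using p by (auto simp: geodesic_path_def)
  define s where "s = W.gp u \<one> (u \<otimes> u)"
  have d: "dS u (u \<otimes> u) = real n" using dist_mult_left[of u \<one> u] u by (simp add: dist_one n_def)
  have s: "s = real n - real (len (u \<otimes> u)) / 2"
    unfolding s_def gromov_product_def using u d W.sym[of u "u \<otimes> u"] by (simp add: dist_one n_def field_simps)
  have small: "real t \<le> 2 * \<delta>" if t: "real t \<le> s" "2 * t \<le> n" for t :: nat
  proof -
    define q r where "q = p (n - t)" and "r = u \<otimes> p t"
    have tn: "t \<le> n" "n - t \<le> n" using t by auto
    have qr: "q \<in> carrier G" "r \<in> carrier G" "p t \<in> carrier G" using pM tn u by (auto simp: q_def r_def)
    have "dS u q = real t" "dS q \<one> = real n - real t"
      using pd[of n "n - t"] pd[of "n - t" 0] tn by (auto simp: pe q_def of_nat_diff)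
    moreover have "dS u \<one> = real n" using u by (simp add: dist_one_right n_def)
    ultimately have 1: "W.gp u q \<one> = real t"
      using W.sym[of u q] W.sym[of u \<one>] u qr by (simp add: gromov_product_def)
    have "dS u r = real t" 
      using dist_mult_left[of u \<one> "p t"] pd[of 0 t] tn u qr by (simp add: r_def pe)
    moreover have "dS r (u \<otimes> u) = real n - real t"
      using dist_mult_left[of u "p t" u] pd[of t n] tn u qr by (simp add: r_def pe)
    ultimately have 2: "W.gp u (u \<otimes> u) r = real t"
      using d W.sym[of u r] W.sym[of u "u \<otimes> u"] W.sym[of r "u \<otimes> u"] u qr by (simp add: gromov_product_def)
    have "s - \<delta> \<le> W.gp u \<one> (u \<otimes> u)" using \<delta> by (simp add: s_def)
    then have "real t - \<delta> \<le> W.gp u q (u \<otimes> u)"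
      using hyp[of u q \<one> "u \<otimes> u"] u qr 1 t by (simp add: s_def min_def split: if_splits)
    then have "real t - 2 * \<delta> \<le> W.gp u q r"
      using hyp[of u q "u \<otimes> u" r] u qr 2 \<delta> by (simp add: min_def split: if_splits)
    then have qr_close: "dS q r \<le> 4 * \<delta>"
      using \<open>dS u q = real t\<close> \<open>dS u r = real t\<close> W.sym[of u q] W.sym[of u r] u qr by (simp add: gromov_product_def)
    have "dS q (u \<otimes> q) = real n"
      using central[OF qr(1)] u qr by (simp add: word_dist_def cancel_inv_left n_def)
    moreover have "dS r (u \<otimes> q) = real n - 2 * real t"
      using dist_mult_left[of u "p t" q] pd[of t "n - t"] tn t u qr by (simp add: r_def q_def of_nat_diff)
    ultimately show ?thesis using W.triangle[of q r "u \<otimes> q"] qr_close u qr by simp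
  qed
  have s0: "0 \<le> s" "s \<le> real n"
    using W.gp_nonneg[of u \<one> "u \<otimes> u"] W.gp_le[of u \<one> "u \<otimes> u"] u by (auto simp: s_def dist_one_right n_def)
  \<comment> \<open>Up to rounding, the largest value to which the preceding estimate applies.\<close>
  define t where "t = min (nat \<lfloor>s\<rfloor>) (n div 2)"
  have "real t \<le> s" "2 * t \<le> n" using s0 unfolding t_def by linarith+
  then have "real t \<le> 2 * \<delta>" by (rule small)
  moreover have "s \<le> 2 * real t + 2" 
  proof -
    have "s \<le> real (nat \<lfloor>s\<rfloor>) + 1" "real n \<le> 2 * real (n div 2) + 1" using s0 by linarith+
    moreover have "real t = real (nat \<lfloor>s\<rfloor>) \<or> real t = real (n div 2)" by (simp add: t_def min_def)
    ultimately show ?thesis using s0 by (elim disjE) linarith+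
  qed
  ultimately show ?thesis unfolding s n_def by simp
qed

end

section \<open>Hyperbolic groups with unique roots\<close>

locale hyperbolic_unique_roots_group = hyperbolic_word_metric G S \<delta> + unique_roots_group G
  for G (structure) and S \<delta>
begin

lemma powers_unbounded:
  assumes k: "k \<in> carrier G" "k \<noteq> \<one>"
  shows "\<exists>m. n \<le> len (k [^] (m::nat))"
proof (rule ccontr)
  assume "\<nexists>m. n \<le> len (k [^] (m::nat))"
  then have "range (\<lambda>m::nat. k [^] m) \<subseteq> {g \<in> carrier G. len g \<le> n}" using k by (auto simp: not_le intro: less_imp_le)
  then have "finite (range (\<lambda>m::nat. k [^] m))" using finite_ball finite_subset by blast
  moreover have "inj (\<lambda>m::nat. k [^] m)"
    using int_pow_inj[OF k] by (intro injI) (metis int_pow_int of_nat_eq_iff)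
  ultimately show False using finite_imageD by blast
qed

text \<open>The conjugates of \<open>k\<close> have bounded length, hence there are finitely many of them. So \<open>h\<^sup>i\<close> and \<open>h\<^sup>j\<close>
  conjugate \<open>k\<close> to the same element for some \<open>i < j\<close>, and \<open>k\<close> commutes with \<open>h\<^bsup>j - i\<^esup>\<close>.\<close>

lemma fixes_boundary_central:
  assumes k: "k \<in> carrier G" and fix_k: "fixes_boundary k" and h: "h \<in> carrier G"
  shows "k \<otimes> h = h \<otimes> k"
proof (cases "k = \<one>")
  case True then show ?thesis using h by simp
next
  case False
  obtain x y where xy: "x \<in> gromov_seqs G S" "y \<in> gromov_seqs G S" "\<And>i. W.gp \<one> (x i) (y i) = 0"
    using opposite_gromov_seqs_exist powers_unbounded[OF k False] nat_pow_closed[OF k] by metis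
  \<comment> \<open>Two equal conjugates by different powers of \<open>h\<close> exist because they all lie in one ball.\<close>
  define c where "c = (\<lambda>i::nat. inv (h [^] i) \<otimes> k \<otimes> h [^] i)"
  have "range c \<subseteq> {g \<in> carrier G. real (len g) \<le> real (len k) + 4 * \<delta>}"
    using fixes_boundary_conjugates_bounded[OF k fix_k xy] h k by (auto simp: c_def)
  then have "finite (range c)" using finite_real_ball finite_subset by blast
  then have "\<not> inj c" using finite_imageD by blast
  then obtain i j where "c i = c j" "i \<noteq> j" by (auto simp: inj_def)
  then obtain i j where ij: "c i = c j" "i < j" by (metis nat_neq_iff)
  define m where "m = j - i"
  have "0 < m" "j = m + i" using ij by (auto simp: m_def)
  have hj: "h [^] j = h [^] m \<otimes> h [^] i" unfolding \<open>j = m + i\<close> using h by (simp add: nat_pow_mult)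
  have "h [^] j \<otimes> c i = h [^] m \<otimes> (k \<otimes> h [^] i)"
    unfolding hj c_def using h k by (simp add: m_assoc cancel_inv_right)
  moreover have "h [^] j \<otimes> c j = k \<otimes> h [^] m \<otimes> h [^] i"
    unfolding c_def using h k by (simp add: m_assoc cancel_inv_right hj)
  ultimately have "(h [^] m \<otimes> k) \<otimes> h [^] i = (k \<otimes> h [^] m) \<otimes> h [^] i" using ij h k by (simp add: m_assoc)
  then have "k \<otimes> h [^] m = h [^] m \<otimes> k" using h k r_cancel[of "h [^] i" "h [^] m \<otimes> k" "k \<otimes> h [^] m"] by simp
  then show ?thesis using commute_if_power_commutes[OF h k \<open>0 < m\<close>] by blast
qed

text \<open>Let \<open>h'\<close> be shortest in its coset of the powers of \<open>k\<close>, and let \<open>v\<close> be a power of \<open>k\<close> of about the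
  same length. Since \<open>h'\<close> and \<open>v\<close> commute, the four-point inequality for \<open>\<one>\<close>, \<open>h'\<close>, \<open>h' v\<close>, \<open>v\<close> gives
  \<open>\<bar>h' v\<bar> + \<bar>h' v\<inverse>\<bar> \<le> 2 \<bar>h'\<bar> + const\<close>, and by minimality both terms are \<open>\<bar>h'\<bar>\<close> up to a constant. But then
  in the quadruple \<open>\<one>\<close>, \<open>v\<close>, \<open>h'\<close>, \<open>v\<inverse>\<close> the sum \<open>\<bar>h'\<bar> + \<bar>v\<^sup>2\<bar>\<close>, about \<open>3 \<bar>v\<bar>\<close>, is at most \<open>2 \<bar>v\<bar>\<close>
  plus a constant, which bounds \<open>\<bar>v\<bar>\<close>.\<close>

lemma central_cosets_bounded:
  assumes k: "k \<in> carrier G" "k \<noteq> \<one>" and central: "\<And>g. g \<in> carrier G \<Longrightarrow> k \<otimes> g = g \<otimes> k"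
  shows "\<exists>C. \<forall>h\<in>carrier G. \<exists>n::int. real (len (h \<otimes> k [^] n)) \<le> C"
proof -
  define c where "c = 2 * real (len k) + 2 * \<delta>"
  have kh: "\<exists>n::int. real (len (h \<otimes> k [^] n)) \<le> c + 10 * \<delta> + 4" if h: "h \<in> carrier G" for h
  proof -
    define n0 where "n0 = (ARG_MIN (\<lambda>n::int. len (h \<otimes> k [^] n)) n. True)"
    define h' where "h' = h \<otimes> k [^] n0"
    have h': "h' \<in> carrier G" using h k by (simp add: h'_def)
    have min: "len h' \<le> len (h' \<otimes> k [^] (j::int))" for j
    proof -
      have "h' \<otimes> k [^] j = h \<otimes> k [^] (n0 + j)" using h k by (simp add: h'_def m_assoc int_pow_mult)
      then show ?thesis unfolding h'_def n0_def by (metis arg_min_nat_le)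
    qed
    \<comment> \<open>The power before \<open>v\<close> is shorter than \<open>h'\<close>, so \<open>v\<close> exceeds the length of \<open>h'\<close> by at most that of \<open>k\<close>.\<close>
    define m where "m = (LEAST m. len h' \<le> len (k [^] (m::nat)))"
    define v where "v = k [^] m"
    have v: "v \<in> carrier G" using k by (simp add: v_def)
    have lv1: "len h' \<le> len v" unfolding v_def m_def using powers_unbounded[OF k] by (rule LeastI_ex)
    have lv2: "len v \<le> len h' + len k"
    proof (cases m)
      case 0 then show ?thesis by (simp add: v_def len_one)
    next
      case (Suc m')
      then have "len (k [^] m') < len h'" using not_less_Least[of m' "\<lambda>m. len h' \<le> len (k [^] m)"] by (simp add: m_def)
      moreover have "len v \<le> len (k [^] m') + len k" using len_mult[of "k [^] m'" k] k by (simp add: v_def Suc)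
      ultimately show ?thesis by simp
    qed
    have v_int: "v = k [^] int m" "inv v = k [^] (- int m)" using k by (simp_all add: v_def int_pow_neg int_pow_int)
    have vc: "v \<otimes> g = g \<otimes> v" if "g \<in> carrier G" for g
      unfolding v_int by (rule central_int_pow[OF k(1) central that])
    define A B where "A = real (len (h' \<otimes> v))" and "B = real (len (h' \<otimes> inv v))"
    have AB: "real (len h') \<le> A" "real (len h') \<le> B" using min[of "int m"] min[of "- int m"] by (simp_all add: A_def B_def flip: v_int)
    have ivc: "inv v \<otimes> h' = h' \<otimes> inv v" using vc[OF h'] v h' by (metis inv_closed inv_solve_left inv_solve_right m_assoc m_closed)
    have dvh: "dS v h' = B" using ivc by (simp add: word_dist_def B_def)
    have dhv: "dS h' v = B" using dvh W.sym v h' by simp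
    have dhi: "dS h' (inv v) = A"
      using W.sym[of h' "inv v"] vc[OF h'] v h' by (simp add: word_dist_def A_def)
    have d1: "dS \<one> (h' \<otimes> v) = A" "dS \<one> h' = real (len h')" "dS \<one> v = real (len v)" "dS \<one> (inv v) = real (len v)"
      using v h' by (simp_all add: dist_one A_def len_inv)
    have d2: "dS (h' \<otimes> v) v = real (len h')"
    proof -
      have "dS (h' \<otimes> v) v = dS v (v \<otimes> h')" using W.sym v h' vc[OF h'] by simp
      then show ?thesis using v h' by (simp add: word_dist_def cancel_inv_left)
    qed
    have d3: "dS h' (h' \<otimes> v) = real (len v)" using v h' by (simp add: word_dist_def cancel_inv_left)
    have "A + B \<le> max (real (len h') + real (len h')) (real (len v) + real (len v)) + 2 * \<delta>"
      using four_point[of \<one> h' "h' \<otimes> v" v] v h' by (simp add: dhv d1 d2 d3)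
    then have AB_le: "A \<le> real (len h') + c" "B \<le> real (len h') + c" using AB lv1 lv2 by (auto simp: c_def)
    have dvv: "dS v (inv v) = real (len (v \<otimes> v))"
      using len_inv[of "v \<otimes> v"] v by (simp add: word_dist_def inv_mult_group)
    have "real (len h') + dS v (inv v) \<le> max (real (len v) + A) (B + real (len v)) + 2 * \<delta>"
      using four_point[of \<one> v h' "inv v"] v h' by (simp add: d1 dvh dhi)
    moreover have "2 * real (len v) \<le> dS v (inv v) + 8 * \<delta> + 4"
      using central_square_length[OF v vc] by (simp add: dvv)
    ultimately have "real (len v) \<le> c + 10 * \<delta> + 4" using AB_le by (auto simp: max_def split: if_splits)
    then have "real (len h') \<le> c + 10 * \<delta> + 4" using lv1 by simp
    then show ?thesis unfolding h'_def by blast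
  qed
  then show ?thesis by blast
qed

text \<open>The powers of \<open>k\<close> have finite index, so by the pigeonhole principle every element has a positive
  power that is a power of \<open>k\<close>, hence central. Unique roots make every element central, and a common
  exponent for the finitely many coset representatives serves for all elements.\<close>

lemma cyclic_if_central_element:
  assumes k: "k \<in> carrier G" "k \<noteq> \<one>" and central: "\<And>g. g \<in> carrier G \<Longrightarrow> k \<otimes> g = g \<otimes> k"
  shows "(\<forall>x\<in>carrier G. \<forall>y\<in>carrier G. x \<otimes> y = y \<otimes> x) \<and>
    (\<exists>e\<in>carrier G. \<forall>h\<in>carrier G. \<exists>n::int. h = e [^] n)"
proof -
  obtain C where C: "\<And>h. h \<in> carrier G \<Longrightarrow> \<exists>n::int. real (len (h \<otimes> k [^] n)) \<le> C"
    using central_cosets_bounded[OF k central] by blast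
  define F where "F = {c \<in> carrier G. real (len c) \<le> C}"
  have "finite F" unfolding F_def by (rule finite_real_ball)
  have pk: "k [^] (n::int) \<otimes> g = g \<otimes> k [^] n" if "g \<in> carrier G" for n g
    by (rule central_int_pow[OF k(1) central that])
  have root: "\<exists>m::nat. 0 < m \<and> (\<exists>n::int. h [^] m = k [^] n)" if h: "h \<in> carrier G" for h
  proof -
    have "\<exists>n::int. h [^] i \<otimes> k [^] n \<in> F" for i :: nat using C[of "h [^] i"] h k by (auto simp: F_def)
    then obtain n :: "nat \<Rightarrow> int" where n: "\<And>i. h [^] i \<otimes> k [^] n i \<in> F" by metis
    have "\<not> inj (\<lambda>i. h [^] i \<otimes> k [^] n i)"
    proof -
      have "range (\<lambda>i. h [^] i \<otimes> k [^] n i) \<subseteq> F" using n by auto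
      then have "finite (range (\<lambda>i. h [^] i \<otimes> k [^] n i))" using \<open>finite F\<close> finite_subset by blast
      then show ?thesis using finite_imageD by blast
    qed
    then obtain i j where "h [^] i \<otimes> k [^] n i = h [^] j \<otimes> k [^] n j" "i \<noteq> j" by (auto simp: inj_def)
    then obtain i j where ij: "h [^] i \<otimes> k [^] n i = h [^] j \<otimes> k [^] n j" "i < j" by (metis nat_neq_iff)
    define m where "m = j - i"
    have m: "0 < m" "j = i + m" using ij by (auto simp: m_def)
    have "h [^] i \<otimes> k [^] n i = h [^] i \<otimes> (h [^] m \<otimes> k [^] n j)"
      unfolding ij(1) m(2) using h k by (simp add: m_assoc flip: nat_pow_mult)
    then have "k [^] n i = h [^] m \<otimes> k [^] n j" using h k by simp
    then have "h [^] m = k [^] (n i - n j)" using h k by (simp add: int_pow_diff inv_solve_right)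
    then show ?thesis using m by blast
  qed
  have comm: "x \<otimes> y = y \<otimes> x" if x: "x \<in> carrier G" and y: "y \<in> carrier G" for x y
  proof -
    obtain m :: nat and n :: int where "0 < m" "y [^] m = k [^] n" using root[OF y] by blast
    then show ?thesis using commute_if_power_commutes[OF y x \<open>0 < m\<close>] pk[OF x] by simp
  qed
  interpret comm_group G using comm by (intro group_comm_groupI) 
  obtain mm where mm: "\<And>h. h \<in> F \<Longrightarrow> 0 < (mm h::nat) \<and> (\<exists>n::int. h [^] mm h = k [^] n)"
    using root unfolding F_def by (metis (no_types, lifting) mem_Collect_eq)
  define M where "M = (\<Prod>h\<in>F. mm h)"
  have "0 < M" using mm by (auto simp: M_def intro: prod_pos)
  have "\<exists>n::int. h [^] int M = k [^] n" if h: "h \<in> carrier G" for h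
  proof -
    obtain n :: int where n: "h \<otimes> k [^] n \<in> F" using C[OF h] h k by (auto simp: F_def)
    define c where "c = h \<otimes> k [^] n"
    have c: "c \<in> carrier G" "c \<in> F" using n h k by (auto simp: c_def)
    obtain l :: int where l: "c [^] mm c = k [^] l" using mm[OF c(2)] by blast
    obtain q where q: "M = mm c * q" using dvd_prodI[OF \<open>finite F\<close> c(2), of mm] by (auto simp: M_def)
    have "c [^] int M = (c [^] int (mm c)) [^] int q" unfolding q using c by (simp add: int_pow_pow)
    also have "c [^] int (mm c) = k [^] l" using l by (simp add: int_pow_int)
    also have "(k [^] l) [^] int q = k [^] (l * int q)" by (rule int_pow_pow[OF k(1)])
    finally have cM: "c [^] int M = k [^] (l * int q)" .
    have "h = c \<otimes> k [^] (- n)" using h k by (simp add: c_def int_pow_neg m_assoc)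
    then have "h [^] int M = k [^] (l * int q) \<otimes> k [^] (- n * int M)"
      using cM c k by (simp add: int_pow_distrib int_pow_pow)
    then show ?thesis using k by (metis int_pow_mult)
  qed
  then show ?thesis
    using cyclic_if_bounded_multiple_in_cyclic_subgroup[OF comm k \<open>0 < M\<close>] comm by blast
qed

lemma automorphism_of_infinite_cyclic_group:
  assumes f: "f \<in> auto G" and e: "e \<in> carrier G" "e \<noteq> \<one>" and cyc: "\<And>h. h \<in> carrier G \<Longrightarrow> \<exists>n::int. h = e [^] n"
  shows "(\<forall>h\<in>carrier G. f h = h) \<or> (\<forall>h\<in>carrier G. f h = inv h)"
proof -
  have fh: "f \<in> hom G G" "f ` carrier G = carrier G" using f by (auto simp: auto_def Bij_def bij_betw_def)
  interpret f: group_hom G G f using fh is_group by (simp add: group_hom_def group_hom_axioms_def)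
  obtain a :: int where a: "f e = e [^] a" using cyc[of "f e"] e by auto
  have fpow: "f (e [^] (n::int)) = e [^] (a * n)" for n
    using f.hom_int_pow[of e n] a e by (simp add: int_pow_pow)
  obtain x where x: "x \<in> carrier G" "f x = e" using fh(2) e by (metis imageE)
  obtain b :: int where "x = e [^] b" using cyc[OF x(1)] by blast
  then have "e [^] (a * b) = e [^] (1::int)" using fpow[of b] x e by simp
  then have "a * b = 1" using int_pow_inj[OF e] by blast
  then have "a = 1 \<or> a = -1" by (auto simp: zmult_eq_1_iff)
  then show ?thesis
  proof
    assume "a = 1"
    then show ?thesis using cyc fpow by (metis mult_1)
  next
    assume "a = -1"
    then have "f h = inv h" if "h \<in> carrier G" for h
      using cyc[OF that] fpow e by (auto simp: int_pow_neg)
    then show ?thesis by blast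
  qed
qed

text \<open>Since \<open>f (g \<xi>) = f g (f \<xi>)\<close> for boundary points \<open>\<xi>\<close>, the element \<open>k = g\<inverse> f g\<close> fixes the boundary
  pointwise and is therefore central. If \<open>k\<close> were nontrivial, the group would be infinite cyclic and \<open>f\<close>
  would be inversion. But \<open>(u | u\<inverse>)\<close> is bounded because \<open>u\<^sup>2\<close> is almost twice as long as \<open>u\<close>, so inversion
  moves every boundary point, and there is one.\<close>

theorem automorphism_trivial_on_boundary_is_trivial:
  assumes f: "f \<in> auto G" and triv: "\<And>x. x \<in> gromov_seqs G S \<Longrightarrow> converge_together x (f \<circ> x)"
    and g: "g \<in> carrier G"
  shows "f g = g"
proof (rule ccontr)
  assume "f g \<noteq> g"
  define k where "k = inv g \<otimes> f g"
  have fh: "f \<in> hom G G" using f by (simp add: auto_def)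
  interpret f: group_hom G G f using fh is_group by (simp add: group_hom_def group_hom_axioms_def)
  have k: "k \<in> carrier G" using g by (simp add: k_def)
  have "k \<noteq> \<one>"
  proof
    assume "k = \<one>"
    then have "g \<otimes> (inv g \<otimes> f g) = g" using g by (simp add: k_def)
    then show False using g \<open>f g \<noteq> g\<close> by (simp add: cancel_inv_right)
  qed
  have "fixes_boundary k"
    unfolding fixes_boundary_def
  proof
    fix x assume x: "x \<in> gromov_seqs G S"
    have xc: "x i \<in> carrier G" for i using gromov_seq_closed[OF x] .
    have "converge_together (\<lambda>i. g \<otimes> x i) (f \<circ> (\<lambda>i. g \<otimes> x i))"
      by (intro triv gromov_seqs_mult_left g x)
    also have "f \<circ> (\<lambda>i. g \<otimes> x i) = (\<lambda>i. f g \<otimes> f (x i))" using g xc by auto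
    finally have 1: "converge_together (\<lambda>i. g \<otimes> x i) (\<lambda>i. f g \<otimes> f (x i))" .
    have "converge_together (\<lambda>i. f (x i)) x"
      using converge_together_sym[OF _ _ triv[OF x]] xc by (simp add: o_def)
    then have 2: "converge_together (\<lambda>i. f g \<otimes> f (x i)) (\<lambda>i. f g \<otimes> x i)"
      using g xc by (intro converge_together_mult_left) auto
    have "converge_together (\<lambda>i. g \<otimes> x i) (\<lambda>i. f g \<otimes> x i)"
      by (rule converge_together_trans[OF _ _ _ 1 2]) (use g xc in auto)
    then have "converge_together (\<lambda>i. inv g \<otimes> (g \<otimes> x i)) (\<lambda>i. inv g \<otimes> (f g \<otimes> x i))"
      using g xc by (intro converge_together_mult_left) auto
    then show "converge_together x (\<lambda>i. k \<otimes> x i)"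
      using g xc by (simp add: cancel_inv_left k_def m_assoc)
  qed
  then have central: "k \<otimes> h = h \<otimes> k" if "h \<in> carrier G" for h
    using fixes_boundary_central[OF k] that by blast
  obtain e where comm: "\<And>x y. x \<in> carrier G \<Longrightarrow> y \<in> carrier G \<Longrightarrow> x \<otimes> y = y \<otimes> x"
    and e: "e \<in> carrier G" "\<And>h. h \<in> carrier G \<Longrightarrow> \<exists>n::int. h = e [^] n"
    using cyclic_if_central_element[OF k \<open>k \<noteq> \<one>\<close> central] by blast
  have "e \<noteq> \<one>" using e(2)[OF k] \<open>k \<noteq> \<one>\<close> by auto
  then have inv: "f h = inv h" if "h \<in> carrier G" for h
    using automorphism_of_infinite_cyclic_group[OF f e(1) _ e(2)] \<open>f g \<noteq> g\<close> g that by blast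
  obtain x where x: "x \<in> gromov_seqs G S"
    using opposite_gromov_seqs_exist powers_unbounded[OF k \<open>k \<noteq> \<one>\<close>] nat_pow_closed[OF k] by metis
  obtain N where N: "\<And>i j. i \<ge> N \<Longrightarrow> j \<ge> N \<Longrightarrow> 4 * \<delta> + 3 \<le> W.gp \<one> (x i) (f (x j))"
    using triv[OF x] unfolding converge_together_def o_def by meson
  define u where "u = x N"
  have u: "u \<in> carrier G" using gromov_seq_closed[OF x] by (simp add: u_def)
  have "4 * \<delta> + 3 \<le> W.gp \<one> u (inv u)" using N[of N N] inv[OF u] by (simp add: u_def)
  moreover have "dS u (inv u) = real (len (u \<otimes> u))"
    using len_inv[of "u \<otimes> u"] u by (simp add: word_dist_def inv_mult_group)
  moreover have "2 * real (len u) \<le> real (len (u \<otimes> u)) + 8 * \<delta> + 4"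
    using central_square_length[OF u] comm[OF u] by blast
  ultimately show False using u by (simp add: gromov_product_def dist_one_right len_inv)
qed

end

theorem corollary1p4:
  fixes G :: "('a, 'b) monoid_scheme" and S :: "'a set"
  assumes "group G"
    and "bi_orderable G"
    and "hyperbolic_group G"
    and "finite_generating_set G S"
  shows "faithful_action (AutoGroup G) (gromov_boundary G S) (boundary_map G S)"
proof -
  \<comment> \<open>Hyperbolicity is known for some generating set \<open>T\<close>, while the boundary is formed with \<open>S\<close>.\<close>
  obtain T \<delta> where "hyperbolic_word_metric G T \<delta>"
    using hyperbolic_group_imp_hyperbolic_word_metric[OF assms(3)] by blast
  then interpret T: hyperbolic_word_metric G T \<delta> .
  interpret hyperbolic_unique_roots_group G T \<delta>
    by unfold_locales (rule T.bi_orderable_unique_roots[OF assms(2)])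
  have "finitely_generated_group G S"
    using assms by (simp add: finitely_generated_group_def finitely_generated_group_axioms_def)
  then have "gromov_seqs G S = gromov_seqs G T" "boundary_rel G S = boundary_rel G T"
    by (rule T.gromov_seqs_boundary_rel_change_generators)+
  then have "gromov_boundary G S = gromov_boundary G T" "boundary_map G S = boundary_map G T"
    by (simp_all add: gromov_boundary_def boundary_map_def fun_eq_iff)
  moreover have "faithful_action (AutoGroup G) (gromov_boundary G T) (boundary_map G T)"
    by (rule T.faithful_action_boundaryI) (rule automorphism_trivial_on_boundary_is_trivial)
  ultimately show ?thesis by simp
qed

end
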